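(* Let $S$ be an Ehresmann monoid and let $X\subseteq S$ be a generating set of $S$ in the signature $(2,1,1,0)$. Then the Ehresmann monoids $\mathcal P(X^*,P(S))$ and $P(S)\rtimes_{\mathcal G}X^*$ are $(2,1,1,0)$-isomorphic. More precisely, every element of $\mathcal P(X^*,P(S))$ can be written in canonical form, and the map $\mathcal P(X^*,P(S))\to P(S)\rtimes_{\mathcal G}X^*$ given on elements in canonical form by $e\mapsto[(e,1,e)]$ for $e\in P(S)$ and $$e_0x_1e_1\cdots e_{n-1}x_ne_n\mapsto[(e_0,x_1,e_1,\dots,e_{n-1},x_n,e_n)]$$ is a $(2,1,1,0)$-isomorphism. In particular, the canonical form of an element of $\mathcal P(X^*,P(S))$ is well defined (unique).
   Context: **Ehresmann monoids.** An Ehresmann semigroup is an algebra $(S;\cdot\,,{}^+,{}^* )$ with $(S;\cdot)$ a semigroup and unary operations satisfying $x^+x=x$, $(x^+y^+)^+=x^+y^+=y^+x^+$, $(xy)^+=(xy^+)^+$, $xx^*=x$, $(x^*y^* )^*=x^*y^*=y^*x^*$, $(xy)^*=(x^*y)^*$, $(x^+)^*=x^+$, $(x^* )^+=x^*$. An Ehresmann monoid is an Ehresmann semigroup with identity element $1$ (in signature $(2,1,1,0)$ the identity is a constant). $P(S)=\{s^+\colon s\in S\}=\{s^*\colon s\in S\}$ is the semilattice of projections ($e\le f$ iff $e=ef$); in a monoid its maximum is $1$. $X^*$ is the free monoid on $X$; for $v\in X^*$, $\overline v\in S$ denotes its value in $S$ (with $\overline 1=1$). **The graph $\mathcal G$.**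 Vertex set $P(S)$; edges are all $(e,1,e)$, $e\in P(S)$, and all $(e,a,f)$ with $a\in X$ (as a letter of $X^*$), $e,f\in P(S)$, $e=(e\overline af)^+$, $f=(e\overline af)^*$. For an edge $c=(e,t,f)$ put $\mathbf d(c)=e$, $\mathbf r(c)=f$. Restrictions and corestrictions: ${}_g|(e,a,f)=(g,a,(g\overline a)^*f)$ for $g\le e$; $(e,a,f)|_h=(e(\overline ah)^+,a,h)$ for $h\le f$; ${}_f|(e,1,e)=(e,1,e)|_f=(f,1,f)$ for $f\le e$. **The monoid $P(S)\rtimes_{\mathcal G}X^*$.** A non-empty directed path with consecutive edges $(e_0,t_1,e_1),\dots,(e_{n-1},t_n,e_n)$ is written $p=(e_0,t_1,e_1,\dots,t_n,e_n)$; $\mathbf d(p)=e_0$, $\mathbf r(p)=e_n$. For $p=p_1\cdots p_n$ with edges $p_i$ and $e_0'\le\mathbf d(p)$, ${}_{e_0'}|p=({}_{e_0'}|p_1)\cdots({}_{e_{n-1}'}|p_n)$ with $e_i'=\mathbf r({}_{e_{i-1}'}|p_i)$; for $e_n'\le\mathbf r(p)$, $p|_{e_n'}=(p_1|_{e_1'})\cdots(p_n|_{e_n'})$ with $e_{i-1}'=\mathbf d(p_i|_{e_i'})$. Let $\sim$ be the congruence on the semicategory of non-empty paths (composition is concatenation) generated by all pairs $(p_1\cdots p_n,(e_0,t_1\cdots t_n,e_n))$ with $n\ge 2$, $p_i=(e_{i-1},t_i,e_i)$ and $(e_0,t_1\cdots t_n,e_n)$ edges of $\mathcal G$. $[p]$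 denotes the $\sim$-class of $p$; $\mathbf d,\mathbf r$, restriction and corestriction are well defined on classes. $P(S)\rtimes_{\mathcal G}X^*$ is the set of all $\sim$-classes with $c\cdot d=(c|_{\mathbf r(c)\mathbf d(d)})({}_{\mathbf r(c)\mathbf d(d)}|d)$ (composition of classes of paths on the right), $c^+=[(\mathbf d(c),1,\mathbf d(c))]$, $c^*=[(\mathbf r(c),1,\mathbf r(c))]$, and identity $[(1_{P(S)},1,1_{P(S)})]$. **The monoid $\mathcal P(X^*,P(S))$ (Branco, Gomes, Gould).** Put $Y=P(S)$, with top element $1_Y$. $X^*$ acts on $Y$ on the left by $t\cdot e=(\overline te)^+$ and on the right by $e\circ t=(e\overline t)^*$; $Y$ acts on itself on both sides by multiplication. These extend to left and right actions of the free product $X^**Y$ (with identities amalgamated) on $Y$. For $u\in X^**Y$ put $u^+=u\cdot1_Y\in Y$ and $u^*=1_Y\circ u\in Y$. $\mathcal P(X^*,Y)$ is the quotient of $X^**Y$ by the minimum congruence such that the operations $u\mapsto u^+$, $u\mapsto u^*$ induce well-defined operations on the quotient which make it an Ehresmann monoid. Elements of $Y$ and $X$ are identified with their images in $\mathcal P(X^*,Y)$. **Canonical form.** The elements in canonical form are the expressions $e$ with $e\in P(S)$ and $e_0x_1e_1\cdots e_{n-1}x_ne_n$ with $n\ge1$, $x_i\in X$, $e_i\in P(S)$, and $(e_{i-1}x_ie_i)^+=e_{i-1}$, $(e_{i-1}x_ie_i)^*=e_i$ (computed in $\mathcal P(X^*,P(S))$) for all $i=1,\dots,n$. *)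

theory Defs
  imports "HOL-Algebra.Group"
begin

section \<open>Ehresmann monoids\<close>

text \<open>Algebras of signature (2,1,1,0): the unary operations \<open>x\<^sup>+\<close> and \<open>x\<^sup>*\<close> are written
  \<open>eplus S x\<close> and \<open>estar S x\<close>.\<close>

record 'a ehresmann = "'a monoid" +
  eplus :: "'a \<Rightarrow> 'a"
  estar :: "'a \<Rightarrow> 'a"

locale ehresmann_monoid = monoid S for S (structure) +
  assumes plus_closed: "x \<in> carrier S \<Longrightarrow> eplus S x \<in> carrier S"
    and star_closed: "x \<in> carrier S \<Longrightarrow> estar S x \<in> carrier S"
    and plus_left: "x \<in> carrier S \<Longrightarrow> eplus S x \<otimes> x = x"
    and plus_mult_plus: "\<lbrakk>x \<in> carrier S; y \<in> carrier S\<rbrakk>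
          \<Longrightarrow> eplus S (eplus S x \<otimes> eplus S y) = eplus S x \<otimes> eplus S y"
    and plus_comm: "\<lbrakk>x \<in> carrier S; y \<in> carrier S\<rbrakk>
          \<Longrightarrow> eplus S x \<otimes> eplus S y = eplus S y \<otimes> eplus S x"
    and plus_mult: "\<lbrakk>x \<in> carrier S; y \<in> carrier S\<rbrakk>
          \<Longrightarrow> eplus S (x \<otimes> y) = eplus S (x \<otimes> eplus S y)"
    and star_right: "x \<in> carrier S \<Longrightarrow> x \<otimes> estar S x = x"
    and star_mult_star: "\<lbrakk>x \<in> carrier S; y \<in> carrier S\<rbrakk>
          \<Longrightarrow> estar S (estar S x \<otimes> estar S y) = estar S x \<otimes> estar S y"
    and star_comm: "\<lbrakk>x \<in> carrier S; y \<in> carrier S\<rbrakk>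
          \<Longrightarrow> estar S x \<otimes> estar S y = estar S y \<otimes> estar S x"
    and star_mult: "\<lbrakk>x \<in> carrier S; y \<in> carrier S\<rbrakk>
          \<Longrightarrow> estar S (x \<otimes> y) = estar S (estar S x \<otimes> y)"
    and star_plus: "x \<in> carrier S \<Longrightarrow> estar S (eplus S x) = eplus S x"
    and plus_star: "x \<in> carrier S \<Longrightarrow> eplus S (estar S x) = estar S x"

definition projs :: "('s, 'm) ehresmann_scheme \<Rightarrow> 's set" where
  "projs S = eplus S ` carrier S"

inductive_set ehr_generate :: "('s, 'm) ehresmann_scheme \<Rightarrow> 's set \<Rightarrow> 's set"
  for S and X where
  one: "\<one>\<^bsub>S\<^esub> \<in> ehr_generate S X"
| incl: "x \<in> X \<Longrightarrow> x \<in> ehr_generate S X"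
| mult: "\<lbrakk>x \<in> ehr_generate S X; y \<in> ehr_generate S X\<rbrakk> \<Longrightarrow> x \<otimes>\<^bsub>S\<^esub> y \<in> ehr_generate S X"
| plus: "x \<in> ehr_generate S X \<Longrightarrow> eplus S x \<in> ehr_generate S X"
| star: "x \<in> ehr_generate S X \<Longrightarrow> estar S x \<in> ehr_generate S X"

definition ehr_iso ::
  "('a, 'm) ehresmann_scheme \<Rightarrow> ('b, 'n) ehresmann_scheme \<Rightarrow> ('a \<Rightarrow> 'b) set" where
  "ehr_iso A B = {\<phi> \<in> iso A B. \<phi> \<one>\<^bsub>A\<^esub> = \<one>\<^bsub>B\<^esub> \<and>
     (\<forall>x\<in>carrier A. \<phi> (eplus A x) = eplus B (\<phi> x) \<and> \<phi> (estar A x) = estar B (\<phi> x))}"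

text \<open>Elements of \<open>X\<^sup>*\<close> are lists over \<open>X\<close>; the following is the value of a word in \<open>S\<close>.\<close>

definition wval :: "('s, 'm) ehresmann_scheme \<Rightarrow> 's list \<Rightarrow> 's" where
  "wval S t = foldr (\<otimes>\<^bsub>S\<^esub>) t \<one>\<^bsub>S\<^esub>"


section \<open>The graph and the monoid of classes of paths\<close>

text \<open>An edge \<open>(e, t, f)\<close> carries a label \<open>t\<close> in \<open>X\<^sup>*\<close> that is empty or a single letter. A letter
  that happens to be the identity of \<open>S\<close> is thus distinguished from the empty word.\<close>

type_synonym 's edge = "'s \<times> 's list \<times> 's"

definition esrc :: "'s edge \<Rightarrow> 's" where "esrc c = fst c"
definition elab :: "'s edge \<Rightarrow> 's list" where "elab c = fst (snd c)"
definition etgt :: "'s edge \<Rightarrow> 's" where "etgt c = snd (snd c)"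

definition edges :: "('s, 'm) ehresmann_scheme \<Rightarrow> 's set \<Rightarrow> 's edge set" where
  "edges S X = {(e, [], e) | e. e \<in> projs S} \<union>
     {(e, [a], f) | e a f. a \<in> X \<and> e \<in> projs S \<and> f \<in> projs S \<and>
        e = eplus S (e \<otimes>\<^bsub>S\<^esub> a \<otimes>\<^bsub>S\<^esub> f) \<and> f = estar S (e \<otimes>\<^bsub>S\<^esub> a \<otimes>\<^bsub>S\<^esub> f)}"

fun edge_restr :: "('s, 'm) ehresmann_scheme \<Rightarrow> 's \<Rightarrow> 's edge \<Rightarrow> 's edge" where
  "edge_restr S g (e, [], f) = (g, [], g)"
| "edge_restr S g (e, t, f) = (g, t, estar S (g \<otimes>\<^bsub>S\<^esub> wval S t) \<otimes>\<^bsub>S\<^esub> f)"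

fun edge_corestr :: "('s, 'm) ehresmann_scheme \<Rightarrow> 's edge \<Rightarrow> 's \<Rightarrow> 's edge" where
  "edge_corestr S (e, [], f) h = (h, [], h)"
| "edge_corestr S (e, t, f) h = (e \<otimes>\<^bsub>S\<^esub> eplus S (wval S t \<otimes>\<^bsub>S\<^esub> h), t, h)"

type_synonym 's path = "'s edge list"

definition psrc :: "'s path \<Rightarrow> 's" where "psrc p = esrc (hd p)"
definition ptgt :: "'s path \<Rightarrow> 's" where "ptgt p = etgt (last p)"

definition paths :: "('s, 'm) ehresmann_scheme \<Rightarrow> 's set \<Rightarrow> 's path set" where
  "paths S X = {p. p \<noteq> [] \<and> set p \<subseteq> edges S X \<and>
     (\<forall>i. Suc i < length p \<longrightarrow> etgt (p ! i) = esrc (p ! Suc i))}"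

fun path_restr :: "('s, 'm) ehresmann_scheme \<Rightarrow> 's \<Rightarrow> 's path \<Rightarrow> 's path" where
  "path_restr S g [] = []"
| "path_restr S g (c # p) =
     edge_restr S g c # path_restr S (etgt (edge_restr S g c)) p"

fun path_corestr :: "('s, 'm) ehresmann_scheme \<Rightarrow> 's path \<Rightarrow> 's \<Rightarrow> 's path" where
  "path_corestr S [] h = []"
| "path_corestr S [c] h = [edge_corestr S c h]"
| "path_corestr S (c # c' # p) h =
     (let q = path_corestr S (c' # p) h in edge_corestr S c (psrc q) # q)"

text \<open>The congruence on the semicategory of non-empty paths.\<close>

inductive_set path_cong ::
  "('s, 'm) ehresmann_scheme \<Rightarrow> 's set \<Rightarrow> ('s path \<times> 's path) set"
  for S and X where
  contract: "\<lbrakk>p \<in> paths S X; length p \<ge> 2; (psrc p, concat (map elab p), ptgt p) \<in> edges S X\<rbrakk>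
     \<Longrightarrow> (p, [(psrc p, concat (map elab p), ptgt p)]) \<in> path_cong S X"
| refl: "p \<in> paths S X \<Longrightarrow> (p, p) \<in> path_cong S X"
| sym: "(p, q) \<in> path_cong S X \<Longrightarrow> (q, p) \<in> path_cong S X"
| trans: "\<lbrakk>(p, q) \<in> path_cong S X; (q, r) \<in> path_cong S X\<rbrakk> \<Longrightarrow> (p, r) \<in> path_cong S X"
| comp: "\<lbrakk>(p, q) \<in> path_cong S X; (p', q') \<in> path_cong S X; ptgt p = psrc p'\<rbrakk>
     \<Longrightarrow> (p @ p', q @ q') \<in> path_cong S X"

definition pclass :: "('s, 'm) ehresmann_scheme \<Rightarrow> 's set \<Rightarrow> 's path \<Rightarrow> 's path set" where
  "pclass S X p = path_cong S X `` {p}"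

definition csrc :: "'s path set \<Rightarrow> 's" where "csrc c = the_elem (psrc ` c)"
definition ctgt :: "'s path set \<Rightarrow> 's" where "ctgt c = the_elem (ptgt ` c)"

definition class_restr ::
  "('s, 'm) ehresmann_scheme \<Rightarrow> 's set \<Rightarrow> 's \<Rightarrow> 's path set \<Rightarrow> 's path set" where
  "class_restr S X g c = (\<Union>p\<in>c. pclass S X (path_restr S g p))"

definition class_corestr ::
  "('s, 'm) ehresmann_scheme \<Rightarrow> 's set \<Rightarrow> 's path set \<Rightarrow> 's \<Rightarrow> 's path set" where
  "class_corestr S X c h = (\<Union>p\<in>c. pclass S X (path_corestr S p h))"

definition class_comp ::
  "('s, 'm) ehresmann_scheme \<Rightarrow> 's set \<Rightarrow> 's path set \<Rightarrow> 's path set \<Rightarrow> 's path set" where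
  "class_comp S X c d = (\<Union>p\<in>c. \<Union>q\<in>d. pclass S X (p @ q))"

text \<open>The monoid \<open>P(S) \<rtimes> X\<^sup>*\<close> (with respect to the graph above).\<close>

definition path_monoid ::
  "('s, 'm) ehresmann_scheme \<Rightarrow> 's set \<Rightarrow> 's path set ehresmann" where
  "path_monoid S X =
    \<lparr> carrier = paths S X // path_cong S X,
      mult = (\<lambda>c d. class_comp S X
                (class_corestr S X c (ctgt c \<otimes>\<^bsub>S\<^esub> csrc d))
                (class_restr S X (ctgt c \<otimes>\<^bsub>S\<^esub> csrc d) d)),
      one = pclass S X [(\<one>\<^bsub>S\<^esub>, [], \<one>\<^bsub>S\<^esub>)],
      eplus = (\<lambda>c. pclass S X [(csrc c, [], csrc c)]),
      estar = (\<lambda>c. pclass S X [(ctgt c, [], ctgt c)]) \<rparr>"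


section \<open>The monoid of Branco, Gomes and Gould\<close>

subsection \<open>The free product of \<open>X\<^sup>*\<close> and \<open>P(S)\<close>\<close>

text \<open>Words over the disjoint union of \<open>X\<^sup>*\<close> and \<open>P(S)\<close>, modulo the congruence generated by the
  multiplication of the two factors and by the identification of both identities with the empty
  word.\<close>

type_synonym 's fpword = "('s list + 's) list"

definition fpwords :: "('s, 'm) ehresmann_scheme \<Rightarrow> 's set \<Rightarrow> 's fpword set" where
  "fpwords S X = lists (lists X <+> projs S)"

inductive_set fp_cong ::
  "('s, 'm) ehresmann_scheme \<Rightarrow> 's set \<Rightarrow> ('s fpword \<times> 's fpword) set"
  for S and X where
  mult_left: "\<lbrakk>s \<in> lists X; t \<in> lists X\<rbrakk> \<Longrightarrow> ([Inl s, Inl t], [Inl (s @ t)]) \<in> fp_cong S X"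
| mult_right: "\<lbrakk>e \<in> projs S; f \<in> projs S\<rbrakk> \<Longrightarrow> ([Inr e, Inr f], [Inr (e \<otimes>\<^bsub>S\<^esub> f)]) \<in> fp_cong S X"
| one_left: "([Inl []], []) \<in> fp_cong S X"
| one_right: "([Inr \<one>\<^bsub>S\<^esub>], []) \<in> fp_cong S X"
| refl: "u \<in> fpwords S X \<Longrightarrow> (u, u) \<in> fp_cong S X"
| sym: "(u, v) \<in> fp_cong S X \<Longrightarrow> (v, u) \<in> fp_cong S X"
| trans: "\<lbrakk>(u, v) \<in> fp_cong S X; (v, w) \<in> fp_cong S X\<rbrakk> \<Longrightarrow> (u, w) \<in> fp_cong S X"
| append: "\<lbrakk>(u, v) \<in> fp_cong S X; (u', v') \<in> fp_cong S X\<rbrakk> \<Longrightarrow> (u @ u', v @ v') \<in> fp_cong S X"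

definition fpclass :: "('s, 'm) ehresmann_scheme \<Rightarrow> 's set \<Rightarrow> 's fpword \<Rightarrow> 's fpword set" where
  "fpclass S X u = fp_cong S X `` {u}"

text \<open>The actions on \<open>P(S)\<close> of the factors, of words, and of elements of the free product.\<close>

fun lact1 :: "('s, 'm) ehresmann_scheme \<Rightarrow> 's list + 's \<Rightarrow> 's \<Rightarrow> 's" where
  "lact1 S (Inl t) e = eplus S (wval S t \<otimes>\<^bsub>S\<^esub> e)"
| "lact1 S (Inr f) e = f \<otimes>\<^bsub>S\<^esub> e"

fun ract1 :: "('s, 'm) ehresmann_scheme \<Rightarrow> 's \<Rightarrow> 's list + 's \<Rightarrow> 's" where
  "ract1 S e (Inl t) = estar S (e \<otimes>\<^bsub>S\<^esub> wval S t)"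
| "ract1 S e (Inr f) = e \<otimes>\<^bsub>S\<^esub> f"

definition lact :: "('s, 'm) ehresmann_scheme \<Rightarrow> 's fpword set \<Rightarrow> 's \<Rightarrow> 's" where
  "lact S c e = the_elem ((\<lambda>u. foldr (lact1 S) u e) ` c)"

definition ract :: "('s, 'm) ehresmann_scheme \<Rightarrow> 's \<Rightarrow> 's fpword set \<Rightarrow> 's" where
  "ract S e c = the_elem ((\<lambda>u. foldl (ract1 S) e u) ` c)"

text \<open>The values of the unary operations lie in \<open>P(S)\<close>, viewed inside the free product.\<close>

definition free_prod ::
  "('s, 'm) ehresmann_scheme \<Rightarrow> 's set \<Rightarrow> 's fpword set ehresmann" where
  "free_prod S X =
    \<lparr> carrier = fpwords S X // fp_cong S X,
      mult = (\<lambda>c d. \<Union>u\<in>c. \<Union>v\<in>d. fpclass S X (u @ v)),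
      one = fpclass S X [],
      eplus = (\<lambda>c. fpclass S X [Inr (lact S c \<one>\<^bsub>S\<^esub>)]),
      estar = (\<lambda>c. fpclass S X [Inr (ract S \<one>\<^bsub>S\<^esub> c)]) \<rparr>"

subsection \<open>The quotient of the free product\<close>

definition monoid_cong :: "('a, 'm) monoid_scheme \<Rightarrow> ('a \<times> 'a) set \<Rightarrow> bool" where
  "monoid_cong A \<theta> \<longleftrightarrow> equiv (carrier A) \<theta> \<and>
     (\<forall>a b c d. (a, b) \<in> \<theta> \<longrightarrow> (c, d) \<in> \<theta> \<longrightarrow> (a \<otimes>\<^bsub>A\<^esub> c, b \<otimes>\<^bsub>A\<^esub> d) \<in> \<theta>)"

definition unary_compatible :: "('a, 'm) ehresmann_scheme \<Rightarrow> ('a \<times> 'a) set \<Rightarrow> bool" where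
  "unary_compatible A \<theta> \<longleftrightarrow>
     (\<forall>a b. (a, b) \<in> \<theta> \<longrightarrow> (eplus A a, eplus A b) \<in> \<theta> \<and> (estar A a, estar A b) \<in> \<theta>)"

definition ehr_quot ::
  "('a, 'm) ehresmann_scheme \<Rightarrow> ('a \<times> 'a) set \<Rightarrow> 'a set ehresmann" where
  "ehr_quot A \<theta> =
    \<lparr> carrier = carrier A // \<theta>,
      mult = (\<lambda>C D. \<Union>a\<in>C. \<Union>b\<in>D. \<theta> `` {a \<otimes>\<^bsub>A\<^esub> b}),
      one = \<theta> `` {\<one>\<^bsub>A\<^esub>},
      eplus = (\<lambda>C. \<Union>a\<in>C. \<theta> `` {eplus A a}),
      estar = (\<lambda>C. \<Union>a\<in>C. \<theta> `` {estar A a}) \<rparr>"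

text \<open>The minimum congruence with Ehresmann quotient is the intersection of all of them; the
  intersection is again one of them because Ehresmann monoids are defined by identities.\<close>

definition ehr_cong :: "('a, 'm) ehresmann_scheme \<Rightarrow> ('a \<times> 'a) set \<Rightarrow> bool" where
  "ehr_cong A \<theta> \<longleftrightarrow>
     monoid_cong A \<theta> \<and> unary_compatible A \<theta> \<and> ehresmann_monoid (ehr_quot A \<theta>)"

definition min_ehr_cong :: "('a, 'm) ehresmann_scheme \<Rightarrow> ('a \<times> 'a) set" where
  "min_ehr_cong A = \<Inter> {\<theta>. ehr_cong A \<theta>}"

definition BGG :: "('s, 'm) ehresmann_scheme \<Rightarrow> 's set \<Rightarrow> 's fpword set set ehresmann" where
  "BGG S X = ehr_quot (free_prod S X) (min_ehr_cong (free_prod S X))"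

text \<open>The images in the quotient of \<open>e\<close> in \<open>P(S)\<close> and of a letter \<open>x\<close> in \<open>X\<close>.\<close>

definition emb_proj :: "('s, 'm) ehresmann_scheme \<Rightarrow> 's set \<Rightarrow> 's \<Rightarrow> 's fpword set set" where
  "emb_proj S X e = min_ehr_cong (free_prod S X) `` {fpclass S X [Inr e]}"

definition emb_letter :: "('s, 'm) ehresmann_scheme \<Rightarrow> 's set \<Rightarrow> 's \<Rightarrow> 's fpword set set" where
  "emb_letter S X x = min_ehr_cong (free_prod S X) `` {fpclass S X [Inl [x]]}"


section \<open>Canonical forms\<close>

text \<open>The expression \<open>e\<^sub>0 x\<^sub>1 e\<^sub>1 \<dots> x\<^sub>n e\<^sub>n\<close> is encoded as \<open>(e\<^sub>0, [(x\<^sub>1, e\<^sub>1), \<dots>, (x\<^sub>n, e\<^sub>n)])\<close>, the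
  case \<open>n = 0\<close> being the expression \<open>e\<^sub>0\<close>.\<close>

type_synonym 's expr = "'s \<times> ('s \<times> 's) list"

fun canonical :: "('s, 'm) ehresmann_scheme \<Rightarrow> 's set \<Rightarrow> 's expr \<Rightarrow> bool" where
  "canonical S X (e, []) \<longleftrightarrow> e \<in> projs S"
| "canonical S X (e, (x, f) # w) \<longleftrightarrow>
     e \<in> projs S \<and> x \<in> X \<and>
     (let u = emb_proj S X e \<otimes>\<^bsub>BGG S X\<^esub> emb_letter S X x \<otimes>\<^bsub>BGG S X\<^esub> emb_proj S X f
      in eplus (BGG S X) u = emb_proj S X e \<and> estar (BGG S X) u = emb_proj S X f) \<and>
     canonical S X (f, w)"

fun expr_val :: "('s, 'm) ehresmann_scheme \<Rightarrow> 's set \<Rightarrow> 's expr \<Rightarrow> 's fpword set set" where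
  "expr_val S X (e, []) = emb_proj S X e"
| "expr_val S X (e, (x, f) # w) =
     emb_proj S X e \<otimes>\<^bsub>BGG S X\<^esub> emb_letter S X x \<otimes>\<^bsub>BGG S X\<^esub> expr_val S X (f, w)"

fun letter_edges :: "'s expr \<Rightarrow> 's edge list" where
  "letter_edges (e, []) = []"
| "letter_edges (e, (x, f) # w) = (e, [x], f) # letter_edges (f, w)"

fun expr_path :: "'s expr \<Rightarrow> 's path" where
  "expr_path (e, []) = [(e, [], e)]"
| "expr_path (e, xe # w) = letter_edges (e, xe # w)"

end

theory Submission
  imports Defs
begin

text \<open>
  Both monoids have the same normal forms, namely the sequences \<open>e\<^sub>0 x\<^sub>1 e\<^sub>1 \<dots> x\<^sub>n e\<^sub>n\<close> in which every
  triple \<open>(e\<^sub>i\<^sub>-\<^sub>1, x\<^sub>i, e\<^sub>i)\<close> is an edge of the graph. The proof makes these path expressions into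
  an Ehresmann monoid \<open>N\<close> (\<open>expr_monoid\<close>) and identifies each of the two given monoids with \<open>N\<close>.

  The product of \<open>N\<close> is built from left actions of the generators alone. A projection \<open>g\<close> restricts
  an expression to \<open>g e\<^sub>0\<close>; a letter \<open>x\<close> puts the edge \<open>((x e\<^sub>0)\<^sup>+, x, (x e\<^sub>0)\<^sup>*)\<close> in front of the
  restriction to \<open>(x e\<^sub>0)\<^sup>*\<close>. The closed formula \<open>proj_letter_act\<close> for \<open>g (x p)\<close> yields the two
  relations \<open>g x (g x)\<^sup>* = g x\<close> (\<open>letter_act_star\<close>) and \<open>(x f)\<^sup>+ x f = x f\<close> (\<open>letter_act_plus\<close>)
  between the actions, from which associativity follows. The domain of a product depends on its
  right factor through the domain of that factor only, and its range on its left factor through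
  the range of that factor only (\<open>expr_mult_src\<close>, \<open>expr_mult_tgt\<close>); these are the axioms linking \<open>+\<close> and \<open>*\<close>
  to the product.

  For the monoid of paths, a contraction can only delete trivial edges, as the contracted label
  has at most one letter. Hence the class of a path is determined by its starting vertex and its
  sequence of letter edges (\<open>path_cong_iff\<close>), and composing a corestriction with a restriction
  becomes the product of \<open>N\<close> (\<open>path_monoid_mult\<close>).

  For the Branco-Gomes-Gould monoid, the free product acts on the path expressions, and letting
  \<open>u\<close> act on the expression \<open>1\<close> is a homomorphism into \<open>N\<close>: the first vertex of the result is
  \<open>u\<^sup>+ = u \<cdot> 1\<close> and the last one is \<open>u\<^sup>* = 1 \<circ> u\<close> (\<open>class_expr_hom\<close>). Its kernel contains the
  minimum Ehresmann congruence, so the quotient maps to \<open>N\<close>. Conversely, in the quotient the value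
  of the expression that a word produces is the value of the word (\<open>word_val_canonical\<close>), since the
  relations used above hold in every Ehresmann monoid. So the map to \<open>N\<close> is inverse to the
  evaluation of canonical forms.
\<close>

section \<open>Projections of an Ehresmann monoid\<close>

context ehresmann_monoid
begin

lemma projs_carrier: "e \<in> projs S \<Longrightarrow> e \<in> carrier S"
  by (auto simp: projs_def plus_closed)

lemma plus_in_projs: "x \<in> carrier S \<Longrightarrow> eplus S x \<in> projs S"
  by (simp add: projs_def)

lemma star_in_projs: "x \<in> carrier S \<Longrightarrow> estar S x \<in> projs S"
  by (metis plus_in_projs plus_star star_closed)

lemma star_proj: "e \<in> projs S \<Longrightarrow> estar S e = e"
  by (auto simp: projs_def star_plus)

lemma plus_proj: "e \<in> projs S \<Longrightarrow> eplus S e = e"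
  by (metis plus_star projs_carrier star_proj)

lemma proj_mult_closed: "\<lbrakk>e \<in> projs S; f \<in> projs S\<rbrakk> \<Longrightarrow> e \<otimes> f \<in> projs S"
  by (metis m_closed plus_in_projs plus_mult_plus plus_proj projs_carrier)

lemma proj_comm: "\<lbrakk>e \<in> projs S; f \<in> projs S\<rbrakk> \<Longrightarrow> e \<otimes> f = f \<otimes> e"
  by (metis plus_comm plus_proj projs_carrier)

lemma proj_idem: "e \<in> projs S \<Longrightarrow> e \<otimes> e = e"
  by (metis plus_left plus_proj projs_carrier)

lemma one_in_projs: "\<one> \<in> projs S"
  by (metis one_closed plus_closed plus_in_projs plus_left r_one)

lemma plus_proj_mult: "\<lbrakk>e \<in> projs S; x \<in> carrier S\<rbrakk> \<Longrightarrow> eplus S (e \<otimes> x) = e \<otimes> eplus S x"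
  by (metis plus_mult plus_mult_plus plus_proj projs_carrier)

lemma star_mult_proj: "\<lbrakk>e \<in> projs S; x \<in> carrier S\<rbrakk> \<Longrightarrow> estar S (x \<otimes> e) = estar S x \<otimes> e"
  by (metis star_mult star_mult_star star_proj projs_carrier)

lemma proj_below: "\<lbrakk>e \<in> projs S; f \<in> projs S\<rbrakk> \<Longrightarrow> e \<otimes> (e \<otimes> f) = e \<otimes> f"
  by (metis m_assoc proj_idem projs_carrier)

lemma mult_star_mult_proj:
  assumes "x \<in> carrier S" "e \<in> projs S"
  shows "x \<otimes> estar S (x \<otimes> e) = x \<otimes> e"
  using assms by (metis m_assoc projs_carrier star_closed star_mult_proj star_right)

lemma star_mult_below:
  assumes "x \<in> carrier S" "e \<in> projs S"
  shows "estar S (x \<otimes> e) \<otimes> e = estar S (x \<otimes> e)"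
  using assms by (metis m_assoc proj_idem projs_carrier star_closed star_mult_proj)

lemma star_mono:
  assumes "x \<in> carrier S" "g \<in> projs S" "h \<in> projs S" "h \<otimes> g = h"
  shows "estar S (h \<otimes> x) \<otimes> estar S (g \<otimes> x) = estar S (h \<otimes> x)"
proof -
  have c: "g \<in> carrier S" "h \<in> carrier S" using assms projs_carrier by auto
  have "estar S (h \<otimes> x) \<otimes> estar S (g \<otimes> x) = estar S ((h \<otimes> x) \<otimes> estar S (g \<otimes> x))"
    using assms c by (simp add: star_mult_proj star_in_projs)
  also have "(h \<otimes> x) \<otimes> estar S (g \<otimes> x) = h \<otimes> ((g \<otimes> x) \<otimes> estar S (g \<otimes> x))"
    using assms c by (metis m_assoc m_closed star_closed)
  also have "\<dots> = h \<otimes> x"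
    using assms c by (metis m_assoc m_closed star_right)
  finally show ?thesis .
qed

end


section \<open>Path expressions and the left actions on them\<close>

locale ehr_letters = ehresmann_monoid S for S :: "('s, 'm) ehresmann_scheme" (structure) +
  fixes X :: "'s set"
  assumes letters_carrier: "X \<subseteq> carrier S"
begin

text \<open>Canonical forms computed in \<open>S\<close> rather than in the quotient of the free product; that the two
  notions coincide is \<open>canonical_iff_path_expr\<close>.\<close>

fun path_expr :: "'s expr \<Rightarrow> bool" where
  "path_expr (e, []) \<longleftrightarrow> e \<in> projs S"
| "path_expr (e, (x, f) # w) \<longleftrightarrow> (e, [x], f) \<in> edges S X \<and> path_expr (f, w)"

text \<open>Replacing the first vertex by a smaller projection \<open>g\<close> forces all later vertices down: this
  yields the largest path expression below the given one that starts at \<open>g\<close>.\<close>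

fun restr_tail :: "'s \<Rightarrow> ('s \<times> 's) list \<Rightarrow> ('s \<times> 's) list" where
  "restr_tail g [] = []"
| "restr_tail g ((x, f) # w) =
     (x, estar S (g \<otimes> x) \<otimes> f) # restr_tail (estar S (g \<otimes> x) \<otimes> f) w"

text \<open>The left action of a projection makes sense for every \<open>g\<close>, as one restricts to the meet of \<open>g\<close>
  with the first vertex.\<close>

definition proj_act :: "'s \<Rightarrow> 's expr \<Rightarrow> 's expr" where
  "proj_act g p = (g \<otimes> fst p, restr_tail (g \<otimes> fst p) (snd p))"

definition letter_act :: "'s \<Rightarrow> 's expr \<Rightarrow> 's expr" where
  "letter_act x p = (eplus S (x \<otimes> fst p),
     (x, estar S (x \<otimes> fst p)) # restr_tail (estar S (x \<otimes> fst p)) (snd p))"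

definition expr_tgt :: "'s expr \<Rightarrow> 's" where
  "expr_tgt p = last (fst p # map snd (snd p))"

lemma letter_carrier: "x \<in> X \<Longrightarrow> x \<in> carrier S"
  using letters_carrier by auto

lemma letter_edge_iff:
  "(e, [x], f) \<in> edges S X \<longleftrightarrow> x \<in> X \<and> e \<in> projs S \<and> f \<in> projs S \<and>
     eplus S (e \<otimes> x \<otimes> f) = e \<and> estar S (e \<otimes> x \<otimes> f) = f"
  by (auto simp: edges_def)

lemma trivial_edge_iff: "(e, [], f) \<in> edges S X \<longleftrightarrow> e \<in> projs S \<and> f = e"
  by (auto simp: edges_def)

lemma edge_cases:
  assumes "c \<in> edges S X"
  obtains (trivial) e where "c = (e, [], e)" "e \<in> projs S"
    | (letter) e x f where "c = (e, [x], f)" "(e, [x], f) \<in> edges S X"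
  using assms unfolding edges_def by blast

lemma path_expr_src: "path_expr p \<Longrightarrow> fst p \<in> projs S"
  by (cases p rule: path_expr.cases) (auto simp: letter_edge_iff)

lemma path_expr_tgt: "path_expr p \<Longrightarrow> expr_tgt p \<in> projs S"
  by (induction p rule: path_expr.induct) (auto simp: expr_tgt_def)

lemma letter_edge_tgt_star:
  assumes "(e, [x], f) \<in> edges S X"
  shows "estar S (e \<otimes> x) \<otimes> f = f"
  using assms by (metis letter_carrier letter_edge_iff m_closed projs_carrier star_mult_proj)

text \<open>The domain survives because \<open>(g x f)\<^sup>+ = (g e x f)\<^sup>+ = g (e x f)\<^sup>+ = g e = g\<close>.\<close>

lemma restr_edge:
  assumes "(e, [x], f) \<in> edges S X" "g \<in> projs S" "g \<otimes> e = g"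
  shows "(g, [x], estar S (g \<otimes> x) \<otimes> f) \<in> edges S X"
proof -
  have 1: "x \<in> X" "e \<in> projs S" "f \<in> projs S" "eplus S (e \<otimes> x \<otimes> f) = e"
    and c: "x \<in> carrier S" "e \<in> carrier S" "f \<in> carrier S" "g \<in> carrier S"
    using assms by (auto simp: letter_edge_iff letter_carrier projs_carrier)
  have 2: "g \<otimes> x \<otimes> (estar S (g \<otimes> x) \<otimes> f) = g \<otimes> x \<otimes> f"
    using c by (metis m_assoc m_closed star_closed star_right)
  have "eplus S (g \<otimes> x \<otimes> f) = eplus S (g \<otimes> (e \<otimes> x \<otimes> f))"
    using c assms(3) by (metis m_assoc m_closed)
  also have "\<dots> = g" using 1 c assms by (simp add: plus_proj_mult)
  finally have 3: "eplus S (g \<otimes> x \<otimes> f) = g" .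
  show ?thesis using 1 c assms 2 3
    by (simp add: letter_edge_iff proj_mult_closed star_in_projs star_mult_proj)
qed

lemma restr_path_expr:
  "\<lbrakk>path_expr (e, w); g \<in> projs S; g \<otimes> e = g\<rbrakk> \<Longrightarrow> path_expr (g, restr_tail g w)"
proof (induction w arbitrary: e g)
  case (Cons c w)
  obtain x f where [simp]: "c = (x, f)" by force
  let ?k = "estar S (g \<otimes> x)"
  have c: "x \<in> carrier S" "f \<in> projs S" "g \<in> carrier S"
    using Cons.prems by (auto simp: letter_edge_iff letter_carrier projs_carrier)
  then have k: "?k \<in> projs S" "?k \<in> carrier S" "f \<in> carrier S" by (auto simp: star_in_projs projs_carrier)
  have "path_expr (?k \<otimes> f, restr_tail (?k \<otimes> f) w)"
    by (rule Cons.IH[of f])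
      (use Cons.prems c k in \<open>auto simp: proj_mult_closed m_assoc proj_idem\<close>)
  then show ?case using Cons.prems by (auto intro: restr_edge)
qed simp

lemma restr_tail_self: "path_expr (e, w) \<Longrightarrow> restr_tail e w = w"
  by (induction w arbitrary: e) (auto simp: letter_edge_tgt_star)

text \<open>Restricting in two steps agrees with restricting at once because \<open>h \<le> g\<close> implies
  \<open>(h x)\<^sup>* \<le> (g x)\<^sup>*\<close>, so the inequality between the two starting points is passed on to the next
  vertex.\<close>

lemma restr_tail_restr:
  assumes "path_expr (e, w)" "g \<in> projs S" "h \<in> projs S" "h \<otimes> g = h"
  shows "restr_tail h (restr_tail g w) = restr_tail h w"
  using assms
proof (induction w arbitrary: e g h)
  case (Cons c w)
  obtain x f where [simp]: "c = (x, f)" by force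
  let ?k = "\<lambda>g. estar S (g \<otimes> x)"
  have c: "x \<in> carrier S" "f \<in> projs S" "g \<in> carrier S" "h \<in> carrier S" "path_expr (f, w)"
    using Cons.prems by (auto simp: letter_edge_iff letter_carrier projs_carrier)
  then have k: "?k g \<in> projs S" "?k g \<in> carrier S" "?k h \<in> projs S" "?k h \<in> carrier S" "f \<in> carrier S"
    by (auto simp: star_in_projs projs_carrier)
  have 1: "?k h \<otimes> (?k g \<otimes> f) = ?k h \<otimes> f"
    using k star_mono[OF c(1) Cons.prems(2-4)] by (metis m_assoc)
  have 2: "?k h \<otimes> f \<otimes> (?k g \<otimes> f) = ?k h \<otimes> f"
  proof -
    have "?k h \<otimes> f \<otimes> (?k g \<otimes> f) = ?k h \<otimes> f \<otimes> (f \<otimes> ?k g)"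
      using k c by (simp add: proj_comm)
    also have "\<dots> = ?k h \<otimes> (f \<otimes> ?k g)"
      using k c by (simp add: m_assoc proj_below)
    also have "\<dots> = ?k h \<otimes> f"
      using k c 1 by (simp add: proj_comm)
    finally show ?thesis .
  qed
  have "restr_tail (?k h \<otimes> f) (restr_tail (?k g \<otimes> f) w) = restr_tail (?k h \<otimes> f) w"
    by (rule Cons.IH[OF c(5) _ _ 2]) (use c k in \<open>auto simp: proj_mult_closed\<close>)
  then show ?case using 1 by simp
qed simp

lemma proj_act_closed: "\<lbrakk>g \<in> projs S; path_expr p\<rbrakk> \<Longrightarrow> path_expr (proj_act g p)"
  unfolding proj_act_def
  by (rule restr_path_expr[of "fst p"])
    (auto simp: path_expr_src proj_mult_closed m_assoc proj_idem projs_carrier)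

lemma letter_act_closed:
  assumes "x \<in> X" "path_expr p"
  shows "path_expr (letter_act x p)"
proof -
  obtain e w where p: "p = (e, w)" by force
  let ?k = "estar S (x \<otimes> e)" and ?l = "eplus S (x \<otimes> e)"
  have e: "e \<in> projs S" and c: "x \<in> carrier S" "e \<in> carrier S"
    using assms p by (auto simp: letter_carrier projs_carrier dest: path_expr_src)
  have "?l \<otimes> x \<otimes> ?k = ?l \<otimes> (x \<otimes> e)"
    using c e by (simp add: m_assoc plus_closed star_closed mult_star_mult_proj)
  then have "?l \<otimes> x \<otimes> ?k = x \<otimes> e" using c by (simp add: plus_left)
  then have "(?l, [x], ?k) \<in> edges S X"
    using assms c by (simp add: letter_edge_iff plus_in_projs star_in_projs)
  moreover have "path_expr (?k, restr_tail ?k w)"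
    by (rule restr_path_expr[of e]) (use assms p c e in \<open>auto simp: star_in_projs star_mult_below\<close>)
  ultimately show ?thesis by (simp add: letter_act_def p)
qed

lemma proj_act_below: "\<lbrakk>path_expr p; g \<otimes> fst p = fst p\<rbrakk> \<Longrightarrow> proj_act g p = p"
  by (simp add: proj_act_def restr_tail_self)

lemma proj_act_one: "path_expr p \<Longrightarrow> proj_act \<one> p = p"
  by (simp add: proj_act_below path_expr_src projs_carrier)

lemma proj_act_mult:
  assumes "g \<in> projs S" "h \<in> projs S" "path_expr p"
  shows "proj_act g (proj_act h p) = proj_act (g \<otimes> h) p"
proof -
  obtain e w where p: "p = (e, w)" by force
  have e: "e \<in> projs S" using path_expr_src[of p] assms p by simp
  have c: "g \<in> carrier S" "h \<in> carrier S" "e \<in> carrier S" using assms e projs_carrier by auto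
  have he: "h \<otimes> e \<in> projs S" using assms e proj_mult_closed by auto
  have "g \<otimes> (h \<otimes> e) \<otimes> (h \<otimes> e) = g \<otimes> (h \<otimes> e)"
    using c he by (simp add: m_assoc[of g] projs_carrier proj_idem)
  then have "restr_tail (g \<otimes> (h \<otimes> e)) (restr_tail (h \<otimes> e) w) = restr_tail (g \<otimes> (h \<otimes> e)) w"
    using assms p he by (intro restr_tail_restr[of e]) (auto simp: proj_mult_closed)
  then show ?thesis by (simp add: proj_act_def p m_assoc c)
qed

text \<open>The key computation: the first edge of \<open>g (x (e, w))\<close> and the point to which \<open>w\<close> is
  restricted depend on \<open>g\<close>, \<open>x\<close> and \<open>e\<close> only through the product \<open>g x e\<close>. All further relations
  between the actions reduce to this.\<close>

lemma proj_letter_act: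
  assumes "g \<in> projs S" "x \<in> X" "path_expr (e, w)"
  shows "proj_act g (letter_act x (e, w)) = (eplus S (g \<otimes> x \<otimes> e),
     (x, estar S (g \<otimes> x \<otimes> e)) # restr_tail (estar S (g \<otimes> x \<otimes> e)) w)"
proof -
  let ?k = "estar S (x \<otimes> e)" and ?l = "eplus S (x \<otimes> e)"
  have e: "e \<in> projs S" using path_expr_src[of "(e, w)"] assms by simp
  have c: "x \<in> carrier S" "e \<in> carrier S" "g \<in> carrier S"
    using assms e by (auto simp: letter_carrier projs_carrier)
  have kl: "?k \<in> projs S" "?l \<in> projs S" "?k \<in> carrier S" "?l \<in> carrier S"
    using c by (auto simp: star_in_projs plus_in_projs star_closed plus_closed)
  have src: "g \<otimes> ?l = eplus S (g \<otimes> x \<otimes> e)"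
    using c assms by (simp add: m_assoc plus_proj_mult)
  have "g \<otimes> ?l \<otimes> x \<otimes> ?k = g \<otimes> (?l \<otimes> (x \<otimes> ?k))" using c kl by (simp add: m_assoc)
  also have "\<dots> = g \<otimes> x \<otimes> e" using c e by (simp add: mult_star_mult_proj plus_left m_assoc)
  finally have "estar S (g \<otimes> ?l \<otimes> x \<otimes> ?k) = estar S (g \<otimes> x \<otimes> e)" by simp
  then have tgt: "estar S (g \<otimes> ?l \<otimes> x) \<otimes> ?k = estar S (g \<otimes> x \<otimes> e)"
    using c kl by (simp add: star_mult_proj)
  have le: "estar S (g \<otimes> x \<otimes> e) \<otimes> ?k = estar S (g \<otimes> x \<otimes> e)"
    using c kl by (metis tgt m_assoc m_closed proj_idem star_closed)
  have "restr_tail (estar S (g \<otimes> x \<otimes> e)) (restr_tail ?k w) = restr_tail (estar S (g \<otimes> x \<otimes> e)) w"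
    using assms c kl le by (intro restr_tail_restr[of e]) (auto simp: star_in_projs)
  then show ?thesis using src tgt by (simp add: proj_act_def letter_act_def)
qed

text \<open>The relation \<open>g x (g x)\<^sup>* = g x\<close>, read as an equation between actions; both sides come from the
  element \<open>g x e\<close> of \<open>S\<close>.\<close>

lemma letter_act_star:
  assumes "g \<in> projs S" "x \<in> X" "path_expr p"
  shows "proj_act g (letter_act x (proj_act (estar S (g \<otimes> x)) p)) = proj_act g (letter_act x p)"
proof -
  obtain e w where p: "p = (e, w)" by force
  let ?k = "estar S (g \<otimes> x)" and ?m = "estar S (g \<otimes> x \<otimes> e)"
  have e: "e \<in> projs S" using path_expr_src[of p] assms p by simp
  have c: "x \<in> carrier S" "e \<in> carrier S" "g \<in> carrier S"
    using assms e by (auto simp: letter_carrier projs_carrier)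
  have k: "?k \<in> projs S" "?k \<in> carrier S" using c by (auto simp: star_in_projs star_closed)
  have m: "?m = ?k \<otimes> e" using c e by (simp add: star_mult_proj)
  have pe: "path_expr (?k \<otimes> e, restr_tail (?k \<otimes> e) w)"
    using proj_act_closed[OF k(1) assms(3)] by (simp add: proj_act_def p)
  have "g \<otimes> x \<otimes> (?k \<otimes> e) = g \<otimes> x \<otimes> e" using c k by (metis m_assoc m_closed star_right)
  moreover have "restr_tail ?m (restr_tail (?k \<otimes> e) w) = restr_tail ?m w"
    unfolding m by (rule restr_tail_self, rule pe)
  ultimately show ?thesis using assms p
    by (simp add: proj_letter_act[OF assms(1,2) pe] proj_letter_act proj_act_def[of ?k])
qed

text \<open>The relation \<open>(x f)\<^sup>+ x f = x f\<close>, read as an equation between actions: the first vertex of the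
  right-hand side is already below \<open>(x f)\<^sup>+\<close>.\<close>

lemma letter_act_plus:
  assumes "f \<in> projs S" "x \<in> X" "path_expr p"
  shows "proj_act (eplus S (x \<otimes> f)) (letter_act x (proj_act f p)) = letter_act x (proj_act f p)"
proof -
  obtain e w where p: "proj_act f p = (e, w)" by force
  have pe: "path_expr (e, w)" using assms proj_act_closed p by metis
  have e: "e \<in> projs S" "f \<otimes> e = e"
    using p path_expr_src[OF pe] path_expr_src[OF assms(3)] assms(1)
    by (auto simp: proj_act_def proj_below)
  have c: "x \<in> carrier S" "e \<in> carrier S" "f \<in> carrier S"
    using assms e by (auto simp: letter_carrier projs_carrier)
  have "eplus S (x \<otimes> f) \<otimes> eplus S (x \<otimes> e) = eplus S (eplus S (x \<otimes> f) \<otimes> (x \<otimes> f \<otimes> e))"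
    using c e by (simp add: plus_proj_mult plus_in_projs m_assoc)
  also have "eplus S (x \<otimes> f) \<otimes> (x \<otimes> f \<otimes> e) = (eplus S (x \<otimes> f) \<otimes> (x \<otimes> f)) \<otimes> e"
    using c by (simp add: m_assoc plus_closed)
  also have "\<dots> = x \<otimes> e"
    using c e by (simp add: plus_left m_assoc)
  finally have "eplus S (x \<otimes> f) \<otimes> fst (letter_act x (e, w)) = fst (letter_act x (e, w))"
    by (simp add: letter_act_def)
  then show ?thesis using proj_act_below letter_act_closed pe assms p by metis
qed

text \<open>One letter of the right action: seen from the last vertex, \<open>g x\<close> acts like \<open>(g x)\<^sup>*\<close>.\<close>

lemma proj_letter_act_tgt:
  assumes "g \<in> projs S" "x \<in> X" "path_expr p"
  shows "expr_tgt (proj_act g (letter_act x p)) = expr_tgt (proj_act (estar S (g \<otimes> x)) p)"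
proof -
  obtain e w where p: "p = (e, w)" by force
  have e: "e \<in> projs S" using path_expr_src[of p] assms p by simp
  have c: "x \<in> carrier S" "e \<in> carrier S" "g \<in> carrier S"
    using assms e by (auto simp: letter_carrier projs_carrier)
  then have "proj_act (estar S (g \<otimes> x)) p =
      (estar S (g \<otimes> x \<otimes> e), restr_tail (estar S (g \<otimes> x \<otimes> e)) w)"
    using e by (simp add: p proj_act_def star_mult_proj)
  then show ?thesis using assms p by (simp add: proj_letter_act expr_tgt_def)
qed

text \<open>Putting an edge in front of an expression that starts below the target of that edge is
  corestriction of the edge: the expression itself is not shrunk.\<close>

lemma edge_act:
  assumes "(e, [x], f) \<in> edges S X" "path_expr (h, w)" "f \<otimes> h = h"
  shows "proj_act e (letter_act x (h, w)) = (e \<otimes> eplus S (x \<otimes> h), (x, h) # w)"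
proof -
  have 1: "x \<in> X" "e \<in> projs S" "f \<in> projs S" "h \<in> projs S" "estar S (e \<otimes> x \<otimes> f) = f"
    using assms path_expr_src by (auto simp: letter_edge_iff)
  then have c: "x \<in> carrier S" "e \<in> carrier S" "f \<in> carrier S" "h \<in> carrier S"
    by (auto simp: letter_carrier projs_carrier)
  have "estar S (e \<otimes> x \<otimes> h) = estar S (e \<otimes> x \<otimes> f \<otimes> h)"
    using c assms(3) by (simp add: m_assoc)
  also have "\<dots> = h" using 1 c assms(3) by (simp add: star_mult_proj)
  finally show ?thesis using 1 c assms
    by (simp add: proj_letter_act restr_tail_self m_assoc plus_proj_mult)
qed

lemma edge_act_self:
  assumes "(e, [x], f) \<in> edges S X" "path_expr (f, w)"
  shows "proj_act e (letter_act x (f, w)) = (e, (x, f) # w)"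
proof -
  have 1: "x \<in> X" "e \<in> projs S" "f \<in> projs S" "eplus S (e \<otimes> x \<otimes> f) = e"
    using assms by (auto simp: letter_edge_iff)
  then have "e \<otimes> eplus S (x \<otimes> f) = e"
    by (metis letter_carrier m_assoc m_closed plus_proj_mult projs_carrier)
  then show ?thesis using edge_act[OF assms] 1 by (simp add: proj_idem)
qed


section \<open>The Ehresmann monoid of path expressions\<close>

text \<open>The product lets the generators occurring in the left factor act one after the other.\<close>

fun tail_act :: "('s \<times> 's) list \<Rightarrow> 's expr \<Rightarrow> 's expr" where
  "tail_act [] q = q"
| "tail_act ((x, f) # w) q = letter_act x (proj_act f (tail_act w q))"

definition expr_mult :: "'s expr \<Rightarrow> 's expr \<Rightarrow> 's expr" where
  "expr_mult p q = proj_act (fst p) (tail_act (snd p) q)"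

definition expr_monoid :: "'s expr ehresmann" where
  "expr_monoid = \<lparr> carrier = Collect path_expr, mult = expr_mult, one = (\<one>, []),
     eplus = (\<lambda>p. (fst p, [])), estar = (\<lambda>p. (expr_tgt p, [])) \<rparr>"

lemma tail_act_closed: "\<lbrakk>path_expr (e, w); path_expr q\<rbrakk> \<Longrightarrow> path_expr (tail_act w q)"
  by (induction w arbitrary: e)
    (auto simp: letter_edge_iff intro!: proj_act_closed letter_act_closed)

lemma expr_mult_closed: "\<lbrakk>path_expr p; path_expr q\<rbrakk> \<Longrightarrow> path_expr (expr_mult p q)"
  unfolding expr_mult_def
  by (rule proj_act_closed) (auto intro: path_expr_src tail_act_closed[of "fst p"])

lemma expr_mult_Nil: "expr_mult (e, []) q = proj_act e q"
  by (simp add: expr_mult_def)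

lemma expr_mult_Cons:
  "expr_mult (e, (x, f) # w) q = proj_act e (letter_act x (expr_mult (f, w) q))"
  by (simp add: expr_mult_def)

text \<open>After \<open>g\<close>, restricting the tail to \<open>g\<close> changes nothing: the factor \<open>(g x)\<^sup>*\<close> inserted at each
  vertex is absorbed by \<open>g x\<close>, and what remains is the claim for the shorter tail.\<close>

lemma tail_act_restr:
  "\<lbrakk>path_expr (e, w); path_expr q; g \<in> projs S\<rbrakk>
    \<Longrightarrow> proj_act g (tail_act (restr_tail g w) q) = proj_act g (tail_act w q)"
proof (induction w arbitrary: e g)
  case (Cons c w)
  obtain x f where [simp]: "c = (x, f)" by force
  let ?k = "estar S (g \<otimes> x)"
  have c: "x \<in> X" "f \<in> projs S" "path_expr (f, w)"
    using Cons.prems by (auto simp: letter_edge_iff)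
  then have k: "?k \<in> projs S" using Cons.prems by (auto simp: star_in_projs projs_carrier letter_carrier)
  have t: "path_expr (tail_act w q)" using tail_act_closed c Cons.prems by auto
  have "proj_act (?k \<otimes> f) (tail_act (restr_tail (?k \<otimes> f) w) q) = proj_act (?k \<otimes> f) (tail_act w q)"
    by (rule Cons.IH) (use c k Cons.prems in \<open>auto simp: proj_mult_closed\<close>)
  also have "\<dots> = proj_act ?k (proj_act f (tail_act w q))"
    using k c t by (simp add: proj_act_mult)
  finally show ?case using Cons.prems c t by (simp add: letter_act_star proj_act_closed)
qed simp

lemma proj_act_expr_mult:
  assumes "g \<in> projs S" "path_expr p" "path_expr q"
  shows "expr_mult (proj_act g p) q = proj_act g (expr_mult p q)"
proof -
  obtain e w where p: "p = (e, w)" by force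
  have e: "e \<in> projs S" using path_expr_src[of p] assms p by simp
  have t: "path_expr (tail_act w q)" using tail_act_closed assms p by auto
  show ?thesis using assms e t
    by (simp add: expr_mult_def p proj_act_def[of g "(e, w)"] tail_act_restr[of e w]
        proj_mult_closed proj_act_mult)
qed

text \<open>Together with \<open>proj_act_expr_mult\<close> this says that the left actions commute with right
  multiplication, which is all that associativity needs.\<close>

lemma letter_act_expr_mult:
  assumes "x \<in> X" "path_expr p" "path_expr q"
  shows "expr_mult (letter_act x p) q = letter_act x (expr_mult p q)"
proof -
  obtain e w where p: "p = (e, w)" by force
  let ?l = "eplus S (x \<otimes> e)" and ?k = "estar S (x \<otimes> e)"
  have e: "e \<in> projs S" using path_expr_src[of p] assms p by simp
  have c: "x \<in> carrier S" "e \<in> carrier S" using assms e by (auto simp: letter_carrier projs_carrier)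
  have kl: "?k \<in> projs S" "?l \<in> projs S" "?l \<in> carrier S"
    using c by (auto simp: star_in_projs plus_in_projs plus_closed)
  have t: "path_expr (tail_act w q)" using tail_act_closed assms p by auto
  have "estar S (?l \<otimes> x) \<otimes> e = estar S (?l \<otimes> (x \<otimes> e))"
    using c e kl by (simp add: star_mult_proj m_assoc[symmetric])
  then have k: "estar S (?l \<otimes> x) \<otimes> e = ?k" using c by (simp add: plus_left)
  have "expr_mult (letter_act x p) q = proj_act ?l (letter_act x (proj_act ?k (tail_act w q)))"
    using assms p kl by (simp add: expr_mult_def letter_act_def[of x "(e, w)"] tail_act_restr[of e w])
  also have "proj_act ?k (tail_act w q) = proj_act (estar S (?l \<otimes> x)) (proj_act e (tail_act w q))"
    using k c e t kl by (simp add: proj_act_mult star_in_projs)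
  also have "proj_act ?l (letter_act x \<dots>) = letter_act x (proj_act e (tail_act w q))"
    using assms e t kl by (simp add: letter_act_star proj_act_closed letter_act_plus)
  finally show ?thesis by (simp add: expr_mult_def p)
qed

lemma expr_mult_assoc:
  assumes "path_expr p" "path_expr q" "path_expr r"
  shows "expr_mult (expr_mult p q) r = expr_mult p (expr_mult q r)"
proof -
  have "expr_mult (expr_mult (e, w) q) r = expr_mult (e, w) (expr_mult q r)"
    if "path_expr (e, w)" for e w
    using that
  proof (induction w arbitrary: e)
    case Nil
    then show ?case using assms by (simp add: expr_mult_Nil proj_act_expr_mult)
  next
    case (Cons c w)
    obtain x f where [simp]: "c = (x, f)" by force
    show ?case using Cons assms
      by (simp add: expr_mult_Cons proj_act_expr_mult letter_act_expr_mult letter_edge_iff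
          letter_act_closed expr_mult_closed)
  qed
  then show ?thesis using assms by (cases p) auto
qed

text \<open>With \<open>t\<close> the last vertex of \<open>p\<close> this is \<open>p p\<^sup>* = p\<close>, with \<open>t = 1\<close> the right unit law.\<close>

lemma expr_mult_proj_right:
  assumes "path_expr p" "t \<in> projs S" "expr_tgt p \<otimes> t = expr_tgt p"
  shows "expr_mult p (t, []) = p"
proof -
  have "expr_mult (e, w) (t, []) = (e, w)"
    if "path_expr (e, w)" "expr_tgt (e, w) \<otimes> t = expr_tgt (e, w)" for e w
    using that
  proof (induction w arbitrary: e)
    case Nil
    then show ?case by (simp add: expr_mult_Nil proj_act_def expr_tgt_def)
  next
    case (Cons c w)
    obtain x f where [simp]: "c = (x, f)" by force
    have "expr_mult (f, w) (t, []) = (f, w)"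
      by (rule Cons.IH) (use Cons.prems in \<open>auto simp: expr_tgt_def\<close>)
    then show ?case using Cons.prems by (simp add: expr_mult_Cons edge_act_self)
  qed
  then show ?thesis using assms by (cases p) auto
qed

lemma expr_mult_one_right: "path_expr p \<Longrightarrow> expr_mult p (\<one>, []) = p"
  by (simp add: expr_mult_proj_right one_in_projs path_expr_tgt projs_carrier)

lemma expr_mult_src: "fst q = fst r \<Longrightarrow> fst (expr_mult p q) = fst (expr_mult p r)"
proof -
  assume "fst q = fst r"
  then have "fst (tail_act w q) = fst (tail_act w r)" for w
    by (induction w) (auto simp: proj_act_def letter_act_def)
  then show ?thesis by (simp add: expr_mult_def proj_act_def)
qed

lemma expr_mult_tgt:
  assumes "path_expr p" "path_expr q"
  shows "expr_tgt (expr_mult p q) = expr_tgt (expr_mult (expr_tgt p, []) q)"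
proof -
  have "expr_tgt (expr_mult (e, w) q) = expr_tgt (proj_act (expr_tgt (e, w)) q)"
    if "path_expr (e, w)" for e w
    using that
  proof (induction w arbitrary: e)
    case Nil
    then show ?case by (simp add: expr_mult_Nil expr_tgt_def)
  next
    case (Cons c w)
    obtain x f where [simp]: "c = (x, f)" by force
    let ?r = "expr_mult (f, w) q"
    have c: "x \<in> X" "e \<in> projs S" "f \<in> projs S" "path_expr (f, w)" "(e, [x], f) \<in> edges S X"
      using Cons.prems by (auto simp: letter_edge_iff)
    have t: "path_expr (tail_act w q)" using tail_act_closed[OF c(4)] assms by simp
    have k: "estar S (e \<otimes> x) \<in> projs S"
      using c by (simp add: star_in_projs letter_carrier projs_carrier)
    have "expr_tgt (expr_mult (e, c # w) q) = expr_tgt (proj_act (estar S (e \<otimes> x)) ?r)"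
      using c assms by (simp add: expr_mult_Cons proj_letter_act_tgt expr_mult_closed)
    also have "proj_act (estar S (e \<otimes> x)) ?r = ?r"
      using c k t by (simp add: expr_mult_def proj_act_mult letter_edge_tgt_star)
    finally show ?case using Cons.IH[OF c(4)] by (simp add: expr_tgt_def)
  qed
  then show ?thesis using assms by (cases p) (auto simp: expr_mult_Nil)
qed

lemma expr_monoid_ehresmann: "ehresmann_monoid expr_monoid"
proof -
  have p: "path_expr (fst p, [])" "path_expr (expr_tgt p, [])" if "path_expr p" for p
    using that path_expr_src path_expr_tgt by auto
  have m: "expr_mult (e, []) (f, []) = (e \<otimes> f, [])" for e f
    by (simp add: expr_mult_Nil proj_act_def)
  have [simp]: "expr_tgt (e, []) = e" for e by (simp add: expr_tgt_def)
  show ?thesis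
  proof unfold_locales
    fix p q assume "p \<in> carrier expr_monoid" "q \<in> carrier expr_monoid"
    then have pq: "path_expr p" "path_expr q" by (auto simp: expr_monoid_def)
    show "eplus expr_monoid (p \<otimes>\<^bsub>expr_monoid\<^esub> q) =
        eplus expr_monoid (p \<otimes>\<^bsub>expr_monoid\<^esub> eplus expr_monoid q)"
      using expr_mult_src[of q "(fst q, [])" p] by (simp add: expr_monoid_def)
    show "estar expr_monoid (p \<otimes>\<^bsub>expr_monoid\<^esub> q) =
        estar expr_monoid (estar expr_monoid p \<otimes>\<^bsub>expr_monoid\<^esub> q)"
      using pq expr_mult_tgt by (simp add: expr_monoid_def)
  qed (auto simp: expr_monoid_def expr_mult_closed expr_mult_assoc p m one_in_projs
      expr_mult_one_right proj_comm path_expr_src path_expr_tgt proj_idem projs_carrier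
      expr_mult_Nil[of \<one>] proj_act_one expr_mult_Nil[of "fst _"] proj_act_below
      expr_mult_proj_right)
qed


section \<open>Paths and their classes\<close>

text \<open>Forgets the trivial edges of a path. For a path consisting of trivial edges only, the starting
  vertex is what is left.\<close>

definition expr_of :: "'s path \<Rightarrow> 's expr" where
  "expr_of p = (psrc p, map (\<lambda>c. (hd (elab c), etgt c)) (filter (\<lambda>c. elab c \<noteq> []) p))"

lemma psrc_Cons [simp]: "psrc (c # p) = esrc c"
  by (simp add: psrc_def)

lemma ptgt_Cons [simp]: "ptgt (c # p) = (if p = [] then etgt c else ptgt p)"
  by (simp add: ptgt_def)

lemma edge_simps [simp]: "esrc (e, t, f) = e" "elab (e, t, f) = t" "etgt (e, t, f) = f"
  by (simp_all add: esrc_def elab_def etgt_def)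

lemma psrc_append: "p \<noteq> [] \<Longrightarrow> psrc (p @ q) = psrc p"
  by (simp add: psrc_def)

lemma fst_expr_of [simp]: "fst (expr_of p) = psrc p"
  by (simp add: expr_of_def)

lemma snd_expr_of_simps [simp]:
  "snd (expr_of []) = []"
  "snd (expr_of ((e, [], f) # p)) = snd (expr_of p)"
  "snd (expr_of ((e, x # t, f) # p)) = (x, f) # snd (expr_of p)"
  "snd (expr_of (p @ q)) = snd (expr_of p) @ snd (expr_of q)"
  by (simp_all add: expr_of_def)

lemma expr_of_eqI: "\<lbrakk>psrc p = e; snd (expr_of p) = w\<rbrakk> \<Longrightarrow> expr_of p = (e, w)"
  by (metis fst_expr_of prod.collapse)

lemma paths_nonempty: "p \<in> paths S X \<Longrightarrow> p \<noteq> []"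
  by (simp add: paths_def)

lemma paths_single: "[c] \<in> paths S X \<longleftrightarrow> c \<in> edges S X"
  by (simp add: paths_def)

lemma paths_Cons:
  assumes "p \<noteq> []"
  shows "c # p \<in> paths S X \<longleftrightarrow> c \<in> edges S X \<and> etgt c = psrc p \<and> p \<in> paths S X"
proof -
  have *: "(\<forall>i. Q i) \<longleftrightarrow> Q 0 \<and> (\<forall>i. Q (Suc i))" for Q :: "nat \<Rightarrow> bool"
    by (metis not0_implies_Suc)
  show ?thesis using assms
    by (subst paths_def, subst mem_Collect_eq, subst *)
      (auto simp: paths_def psrc_def hd_conv_nth)
qed

lemma path_induct [consumes 1, case_names trivial letter trivial_Cons letter_Cons]:
  assumes "p \<in> paths S X"
    and "\<And>e. e \<in> projs S \<Longrightarrow> Q [(e, [], e)]"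
    and "\<And>e x f. (e, [x], f) \<in> edges S X \<Longrightarrow> Q [(e, [x], f)]"
    and "\<And>e p. \<lbrakk>e \<in> projs S; p \<in> paths S X; psrc p = e; Q p\<rbrakk> \<Longrightarrow> Q ((e, [], e) # p)"
    and "\<And>e x f p. \<lbrakk>(e, [x], f) \<in> edges S X; p \<in> paths S X; psrc p = f; Q p\<rbrakk>
          \<Longrightarrow> Q ((e, [x], f) # p)"
  shows "Q p"
  using assms(1)
proof (induction p)
  case Nil
  then show ?case by (simp add: paths_def)
next
  case (Cons c p)
  show ?case
  proof (cases "p = []")
    case True
    then have "c \<in> edges S X" using Cons.prems by (simp add: paths_single)
    then show ?thesis by (cases rule: edge_cases) (use True assms in auto)
  next
    case False
    then have 1: "c \<in> edges S X" "etgt c = psrc p" "p \<in> paths S X"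
      using Cons.prems by (auto simp: paths_Cons)
    show ?thesis
      using 1(1) by (cases rule: edge_cases) (use 1 Cons.IH assms in auto)
  qed
qed

lemma path_expr_expr_of: "p \<in> paths S X \<Longrightarrow> path_expr (expr_of p)"
proof (induction p rule: path_induct)
  case (trivial e)
  then have "path_expr (e, [])" by simp
  moreover have "expr_of [(e, [], e)] = (e, [])" by (simp add: expr_of_def)
  ultimately show ?case by simp
next
  case (letter e x f)
  then have "path_expr (e, [(x, f)])" by (auto simp: letter_edge_iff)
  moreover have "expr_of [(e, [x], f)] = (e, [(x, f)])" by (simp add: expr_of_def)
  ultimately show ?case by simp
next
  case (trivial_Cons e p)
  then have "expr_of ((e, [], e) # p) = expr_of p" by (simp add: expr_of_def)
  then show ?case using trivial_Cons by simp
next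
  case (letter_Cons e x f p)
  have "expr_of p = (f, snd (expr_of p))" by (rule expr_of_eqI) (simp_all add: letter_Cons(3))
  moreover have "expr_of ((e, [x], f) # p) = (e, (x, f) # snd (expr_of p))"
    by (rule expr_of_eqI) auto
  ultimately show ?case using letter_Cons by (metis path_expr.simps(2))
qed

lemma expr_tgt_expr_of: "p \<in> paths S X \<Longrightarrow> expr_tgt (expr_of p) = ptgt p"
  by (induction p rule: path_induct) (auto simp: expr_tgt_def paths_nonempty)

lemma labels_expr_of: "p \<in> paths S X \<Longrightarrow> concat (map elab p) = map fst (snd (expr_of p))"
  by (induction p rule: path_induct) auto

lemma psrc_projs: "p \<in> paths S X \<Longrightarrow> psrc p \<in> projs S"
  by (induction p rule: path_induct) (auto simp: letter_edge_iff)

lemma ptgt_projs: "p \<in> paths S X \<Longrightarrow> ptgt p \<in> projs S"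
  by (induction p rule: path_induct) (auto simp: letter_edge_iff)

lemma paths_append:
  "\<lbrakk>p \<in> paths S X; q \<in> paths S X; ptgt p = psrc q\<rbrakk> \<Longrightarrow> p @ q \<in> paths S X"
  by (induction p rule: path_induct)
    (auto simp: paths_Cons paths_nonempty trivial_edge_iff psrc_append)

text \<open>A path that contracts to one edge has at most one letter edge, and then the contracted edge is
  this letter edge, since source and target are unaffected by trivial edges.\<close>

lemma path_cong_expr_of:
  "(p, q) \<in> path_cong S X \<Longrightarrow> p \<in> paths S X \<and> q \<in> paths S X \<and> expr_of p = expr_of q"
proof (induction rule: path_cong.induct)
  case (contract p)
  let ?c = "(psrc p, concat (map elab p), ptgt p)"
  have "expr_of p = expr_of [?c]"
    using contract(3)
  proof (cases rule: edge_cases)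
    case (trivial e)
    then have "snd (expr_of p) = []" using labels_expr_of contract(1) by simp
    then show ?thesis using trivial by (simp add: expr_of_def)
  next
    case (letter e x f)
    then obtain g where "snd (expr_of p) = [(x, g)]"
      using labels_expr_of[OF contract(1)] by auto
    moreover from this have "g = f"
      using expr_tgt_expr_of[OF contract(1)] letter by (simp add: expr_tgt_def)
    ultimately show ?thesis using letter by (simp add: expr_of_def)
  qed
  then show ?case using contract by (simp add: paths_single)
next
  case (comp p q p' q')
  have "ptgt q = psrc q'" using comp by (metis expr_tgt_expr_of fst_expr_of)
  moreover have "psrc p = psrc q" using comp by (metis fst_expr_of)
  moreover have "expr_of (p @ p') = (psrc p, snd (expr_of p) @ snd (expr_of p'))"
    using comp by (intro expr_of_eqI) (auto simp: psrc_append paths_nonempty)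
  moreover have "expr_of (q @ q') = (psrc q, snd (expr_of q) @ snd (expr_of q'))"
    using comp by (intro expr_of_eqI) (auto simp: psrc_append paths_nonempty)
  ultimately show ?case using comp by (simp add: paths_append)
qed auto

lemma trivial_Cons_cong:
  assumes "q \<in> paths S X"
  shows "((psrc q, [], psrc q) # q, q) \<in> path_cong S X"
proof -
  obtain c r where q: "q = c # r" using paths_nonempty[OF assms] by (cases q) auto
  let ?e = "(esrc c, [], esrc c)"
  have c: "c \<in> edges S X" using assms q by (cases "r = []") (auto simp: paths_single paths_Cons)
  have ec: "[?e, c] \<in> paths S X"
    using assms q c psrc_projs[OF assms] by (simp add: paths_Cons paths_single trivial_edge_iff)
  have 1: "([?e, c], [c]) \<in> path_cong S X"
    using path_cong.contract[OF ec] c by (simp add: esrc_def elab_def etgt_def)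
  show ?thesis
  proof (cases "r = []")
    case True
    then show ?thesis using 1 q by simp
  next
    case False
    then have "r \<in> paths S X" "etgt c = psrc r" using assms q by (auto simp: paths_Cons)
    then show ?thesis using path_cong.comp[OF 1 path_cong.refl[of r]] q by simp
  qed
qed

lemma letter_trivial_cong:
  assumes "(e, [x], f) \<in> edges S X"
  shows "([(e, [x], f), (f, [], f)], [(e, [x], f)]) \<in> path_cong S X"
proof -
  have "[(e, [x], f), (f, [], f)] \<in> paths S X"
    using assms by (auto simp: paths_Cons paths_single trivial_edge_iff letter_edge_iff)
  from path_cong.contract[OF this] show ?thesis using assms by simp
qed

lemma expr_path_Cons: "w \<noteq> [] \<Longrightarrow> expr_path (e, (x, f) # w) = (e, [x], f) # expr_path (f, w)"
  by (cases w) auto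

lemma expr_path_paths:
  "path_expr p \<Longrightarrow> expr_path p \<in> paths S X \<and> expr_of (expr_path p) = p"
proof (induction p rule: path_expr.induct)
  case (1 e)
  then show ?case by (simp add: paths_single trivial_edge_iff expr_of_def)
next
  case (2 e x f w)
  show ?case
  proof (cases "w = []")
    case True
    then show ?thesis using 2 by (simp add: paths_single expr_of_def)
  next
    case False
    have IH: "expr_path (f, w) \<in> paths S X" "expr_of (expr_path (f, w)) = (f, w)" using 2 by auto
    then have "psrc (expr_path (f, w)) = f" by (metis fst_expr_of fst_conv)
    then show ?thesis using IH 2 False paths_nonempty[OF IH(1)]
      by (auto simp: expr_path_Cons paths_Cons simp del: expr_path.simps(2) intro!: expr_of_eqI)
  qed
qed

text \<open>A trivial edge is absorbed by the edge to its right if there is one; at the end of a path it is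
  absorbed by a letter edge to its left.\<close>

lemma path_cong_expr_path: "p \<in> paths S X \<Longrightarrow> (p, expr_path (expr_of p)) \<in> path_cong S X"
proof (induction p rule: path_induct)
  case (trivial e)
  then show ?case by (simp add: expr_of_def path_cong.refl paths_single trivial_edge_iff)
next
  case (letter e x f)
  then show ?case by (simp add: expr_of_def path_cong.refl paths_single)
next
  case (trivial_Cons e p)
  then have "expr_of ((e, [], e) # p) = expr_of p" by (simp add: expr_of_def)
  then show ?case using trivial_Cons trivial_Cons_cong[of p] by (auto intro: path_cong.trans)
next
  case (letter_Cons e x f p)
  let ?c = "(e, [x], f)" and ?w = "snd (expr_of p)"
  have p: "expr_of p = (f, ?w)" by (rule expr_of_eqI) (simp_all add: letter_Cons(3))
  have e: "expr_of (?c # p) = (e, (x, f) # ?w)" by (rule expr_of_eqI) auto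
  have "([?c], [?c]) \<in> path_cong S X" using letter_Cons by (simp add: path_cong.refl paths_single)
  from path_cong.comp[OF this letter_Cons(4)]
  have 1: "(?c # p, ?c # expr_path (f, ?w)) \<in> path_cong S X" using letter_Cons p by simp
  show ?case
  proof (cases "?w = []")
    case True
    then show ?thesis using 1 e letter_trivial_cong[OF letter_Cons(1)]
      by (auto intro: path_cong.trans)
  next
    case False
    then show ?thesis using 1 e by (simp add: expr_path_Cons del: expr_path.simps(2))
  qed
qed

lemma path_cong_iff:
  "(p, q) \<in> path_cong S X \<longleftrightarrow> p \<in> paths S X \<and> q \<in> paths S X \<and> expr_of p = expr_of q"
proof
  assume *: "p \<in> paths S X \<and> q \<in> paths S X \<and> expr_of p = expr_of q"
  then have "(p, expr_path (expr_of p)) \<in> path_cong S X" "(expr_path (expr_of p), q) \<in> path_cong S X"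
    using path_cong_expr_path path_cong.sym by metis+
  then show "(p, q) \<in> path_cong S X" by (rule path_cong.trans)
qed (rule path_cong_expr_of)

lemma pclass_eq: "p \<in> paths S X \<Longrightarrow> pclass S X p = {q \<in> paths S X. expr_of q = expr_of p}"
  by (auto simp: pclass_def path_cong_iff)

lemma pclass_cong: "\<lbrakk>p \<in> paths S X; q \<in> paths S X; expr_of p = expr_of q\<rbrakk> \<Longrightarrow> pclass S X p = pclass S X q"
  by (simp add: pclass_eq)

lemma pclass_self: "p \<in> paths S X \<Longrightarrow> p \<in> pclass S X p"
  by (simp add: pclass_eq)

lemma csrc_pclass:
  assumes "p \<in> paths S X"
  shows "csrc (pclass S X p) = psrc p"
proof -
  have "psrc q = psrc p" if "q \<in> pclass S X p" for q
    using that assms by (auto simp: pclass_eq dest: arg_cong[of _ _ fst])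
  then show ?thesis
    unfolding csrc_def by (rule the_elem_image_unique[rotated]) (use pclass_self[OF assms] in auto)
qed

lemma ctgt_pclass:
  assumes "p \<in> paths S X"
  shows "ctgt (pclass S X p) = ptgt p"
proof -
  have "ptgt q = ptgt p" if "q \<in> pclass S X p" for q
    using that assms expr_tgt_expr_of[of p] expr_tgt_expr_of[of q] by (auto simp: pclass_eq)
  then show ?thesis
    unfolding ctgt_def by (rule the_elem_image_unique[rotated]) (use pclass_self[OF assms] in auto)
qed

lemma path_restr_expr_of:
  "\<lbrakk>p \<in> paths S X; g \<in> projs S; g \<otimes> psrc p = g\<rbrakk> \<Longrightarrow> path_restr S g p \<in> paths S X \<and>
     psrc (path_restr S g p) = g \<and> snd (expr_of (path_restr S g p)) = restr_tail g (snd (expr_of p))"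
proof (induction p arbitrary: g rule: path_induct)
  case (trivial e)
  then show ?case by (simp add: paths_single trivial_edge_iff)
next
  case (letter e x f)
  then have "x \<in> carrier S" by (simp add: letter_edge_iff letter_carrier)
  then show ?case using letter by (simp add: paths_single restr_edge wval_def)
next
  case (trivial_Cons e p)
  then have "path_restr S g p \<in> paths S X" "psrc (path_restr S g p) = g" by auto
  then show ?case using trivial_Cons paths_nonempty
    by (simp add: paths_Cons trivial_edge_iff)
next
  case (letter_Cons e x f p)
  let ?k = "estar S (g \<otimes> x)"
  have c: "x \<in> carrier S" "f \<in> projs S" "f \<in> carrier S" "g \<in> carrier S"
    using letter_Cons by (auto simp: letter_edge_iff letter_carrier projs_carrier)
  have k: "?k \<in> projs S" "?k \<in> carrier S" using c by (auto simp: star_in_projs star_closed)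
  have "?k \<otimes> f \<otimes> f = ?k \<otimes> f" using c k by (simp add: m_assoc proj_idem)
  then have "path_restr S (?k \<otimes> f) p \<in> paths S X" "psrc (path_restr S (?k \<otimes> f) p) = ?k \<otimes> f"
    "snd (expr_of (path_restr S (?k \<otimes> f) p)) = restr_tail (?k \<otimes> f) (snd (expr_of p))"
    using letter_Cons.IH[of "?k \<otimes> f"] letter_Cons.hyps c k by (auto simp: proj_mult_closed)
  then show ?case using letter_Cons c restr_edge[of e x f g] paths_nonempty
    by (simp add: paths_Cons wval_def)
qed

lemma path_corestr_Cons:
  "p \<noteq> [] \<Longrightarrow> path_corestr S (c # p) h =
     edge_corestr S c (psrc (path_corestr S p h)) # path_corestr S p h"
  by (cases p) (auto simp: Let_def)

lemma corestr_edge: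
  assumes "(e, [x], f) \<in> edges S X" "h \<in> projs S" "f \<otimes> h = h"
  shows "(e \<otimes> eplus S (x \<otimes> h), [x], h) \<in> edges S X"
proof -
  have "path_expr (proj_act e (letter_act x (h, [])))"
    using assms by (intro proj_act_closed letter_act_closed) (auto simp: letter_edge_iff)
  then show ?thesis using assms by (simp add: edge_act[OF assms(1)])
qed

text \<open>Corestriction runs from right to left, in the same order as the actions that make up a product.
  Hence multiplying by an expression that starts at \<open>h\<close>, below the end of \<open>p\<close>, leaves this
  expression untouched and puts the corestriction of \<open>p\<close> in front of it.\<close>

lemma path_corestr_expr_of:
  assumes "p \<in> paths S X" "path_expr (h, w)" "ptgt p \<otimes> h = h"
  shows "path_corestr S p h \<in> paths S X \<and> ptgt (path_corestr S p h) = h \<and>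
     psrc p \<otimes> psrc (path_corestr S p h) = psrc (path_corestr S p h) \<and>
     expr_mult (expr_of p) (h, w) =
       (psrc (path_corestr S p h), snd (expr_of (path_corestr S p h)) @ w)"
  using assms(1,3)
proof (induction p rule: path_induct)
  case (trivial e)
  have "h \<in> projs S" using assms(2) path_expr_src[of "(h, w)"] by simp
  moreover have "proj_act e (h, w) = (h, w)" using trivial assms(2) by (simp add: proj_act_below)
  moreover have "expr_of [(e, [], e)] = (e, [])" by (rule expr_of_eqI) simp_all
  ultimately show ?case using trivial by (simp add: paths_single trivial_edge_iff expr_mult_Nil)
next
  case (letter e x f)
  have h: "h \<in> projs S" using assms(2) path_expr_src[of "(h, w)"] by simp
  have c: "x \<in> carrier S" "e \<in> projs S" "h \<in> carrier S" "f \<in> projs S"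
    using h letter by (auto simp: letter_edge_iff letter_carrier projs_carrier)
  have "proj_act f (h, w) = (h, w)" using letter assms(2) by (simp add: proj_act_below)
  moreover have "expr_of [(e, [x], f)] = (e, [(x, f)])" by (rule expr_of_eqI) simp_all
  ultimately show ?case using letter h c assms(2)
    by (simp add: paths_single corestr_edge expr_mult_Cons expr_mult_Nil edge_act[OF letter(1)]
        wval_def proj_below plus_in_projs)
next
  case (trivial_Cons e p)
  let ?q = "path_corestr S p h"
  have IH: "?q \<in> paths S X" "ptgt ?q = h" "e \<otimes> psrc ?q = psrc ?q"
    "expr_mult (expr_of p) (h, w) = (psrc ?q, snd (expr_of ?q) @ w)"
    using trivial_Cons by (auto simp: paths_nonempty)
  have "expr_of ((e, [], e) # p) = expr_of p" using trivial_Cons by (simp add: expr_of_def)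
  then show ?case using IH trivial_Cons(2) psrc_projs[OF IH(1)]
    by (simp add: path_corestr_Cons paths_nonempty paths_Cons trivial_edge_iff)
next
  case (letter_Cons e x f p)
  let ?q = "path_corestr S p h" and ?h = "psrc (path_corestr S p h)"
  have IH: "?q \<in> paths S X" "ptgt ?q = h" "f \<otimes> ?h = ?h"
    "expr_mult (expr_of p) (h, w) = (?h, snd (expr_of ?q) @ w)"
    using letter_Cons by (auto simp: paths_nonempty)
  have h: "?h \<in> projs S" by (rule psrc_projs[OF IH(1)])
  have c: "x \<in> carrier S" "e \<in> projs S" "?h \<in> carrier S"
    using h letter_Cons by (auto simp: letter_edge_iff letter_carrier projs_carrier)
  have e: "expr_of ((e, [x], f) # p) = (e, (x, f) # snd (expr_of p))" by (rule expr_of_eqI) auto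
  have p: "expr_of p = (f, snd (expr_of p))" by (rule expr_of_eqI) (simp_all add: letter_Cons(3))
  have "path_expr (?h, snd (expr_of ?q) @ w)"
    using expr_mult_closed[OF path_expr_expr_of[OF letter_Cons(2)] assms(2)] IH by simp
  from edge_act[OF letter_Cons(1) this IH(3)]
  have "expr_mult (expr_of ((e, [x], f) # p)) (h, w) =
      (e \<otimes> eplus S (x \<otimes> ?h), (x, ?h) # snd (expr_of ?q) @ w)"
    unfolding e expr_mult_Cons using IH p by simp
  then show ?case using IH letter_Cons h c corestr_edge[OF letter_Cons(1) h]
    by (simp add: path_corestr_Cons paths_nonempty paths_Cons wval_def proj_below plus_in_projs)
qed

lemma class_restr_pclass:
  assumes "p \<in> paths S X" "g \<in> projs S" "g \<otimes> psrc p = g"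
  shows "class_restr S X g (pclass S X p) = pclass S X (path_restr S g p)"
proof -
  have "pclass S X (path_restr S g q) = pclass S X (path_restr S g p)" if "q \<in> pclass S X p" for q
  proof -
    have q: "q \<in> paths S X" "expr_of q = expr_of p" using that assms by (auto simp: pclass_eq)
    then have "psrc q = psrc p" by (metis fst_expr_of)
    then show ?thesis using path_restr_expr_of[OF assms] path_restr_expr_of[OF q(1) assms(2)] assms q
      by (intro pclass_cong prod_eqI) auto
  qed
  then show ?thesis
    unfolding class_restr_def by (intro UN_constant_eq[OF pclass_self[OF assms(1)]] ballI)
qed

lemma class_corestr_pclass:
  assumes "p \<in> paths S X" "h \<in> projs S" "ptgt p \<otimes> h = h"
  shows "class_corestr S X (pclass S X p) h = pclass S X (path_corestr S p h)"
proof -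
  have h: "path_expr (h, [])" using assms by simp
  have "pclass S X (path_corestr S q h) = pclass S X (path_corestr S p h)" if "q \<in> pclass S X p" for q
  proof -
    have q: "q \<in> paths S X" "expr_of q = expr_of p" using that assms by (auto simp: pclass_eq)
    then have "ptgt q = ptgt p" using assms by (metis expr_tgt_expr_of)
    then show ?thesis
      using path_corestr_expr_of[OF assms(1) h assms(3)] path_corestr_expr_of[OF q(1) h] assms q
      by (intro pclass_cong prod_eqI) auto
  qed
  then show ?thesis
    unfolding class_corestr_def by (intro UN_constant_eq[OF pclass_self[OF assms(1)]] ballI)
qed

lemma class_comp_pclass:
  assumes "p \<in> paths S X" "q \<in> paths S X" "ptgt p = psrc q"
  shows "class_comp S X (pclass S X p) (pclass S X q) = pclass S X (p @ q)"
proof -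
  have "pclass S X (p' @ q') = pclass S X (p @ q)"
    if "p' \<in> pclass S X p" "q' \<in> pclass S X q" for p' q'
  proof -
    have "(p', p) \<in> path_cong S X" "(q', q) \<in> path_cong S X" "ptgt p' = psrc q'"
      using that assms by (auto simp: pclass_eq path_cong_iff) (metis expr_tgt_expr_of fst_expr_of)
    then have "(p' @ q', p @ q) \<in> path_cong S X" by (rule path_cong.comp)
    then show ?thesis using path_cong_expr_of pclass_cong by blast
  qed
  then show ?thesis
    unfolding class_comp_def
    by (intro UN_constant_eq[OF pclass_self[OF assms(1)]] UN_constant_eq[OF pclass_self[OF assms(2)]] ballI)
qed

lemma path_monoid_mult:
  assumes "p \<in> paths S X" "q \<in> paths S X"
  shows "pclass S X p \<otimes>\<^bsub>path_monoid S X\<^esub> pclass S X q =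
    pclass S X (expr_path (expr_mult (expr_of p) (expr_of q)))"
proof -
  let ?h = "ptgt p \<otimes> psrc q" and ?w = "snd (expr_of q)"
  let ?p = "path_corestr S p ?h" and ?q = "path_restr S ?h q"
  have e: "ptgt p \<in> projs S" "psrc q \<in> projs S" using assms ptgt_projs psrc_projs by auto
  then have h: "?h \<in> projs S" "?h \<otimes> psrc q = ?h" "ptgt p \<otimes> ?h = ?h"
    by (auto simp: proj_mult_closed m_assoc projs_carrier proj_idem proj_below)
  have q: "?q \<in> paths S X" "psrc ?q = ?h" "snd (expr_of ?q) = restr_tail ?h ?w"
    using path_restr_expr_of assms h by auto
  have t: "proj_act (ptgt p) (expr_of q) = (?h, restr_tail ?h ?w)"
    by (simp add: proj_act_def)
  then have pe: "path_expr (?h, restr_tail ?h ?w)"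
    using proj_act_closed[OF e(1) path_expr_expr_of[OF assms(2)]] by simp
  note c = path_corestr_expr_of[OF assms(1) pe h(3)]
  \<comment> \<open>Inserting \<open>p\<^sup>*\<close> between the factors restricts \<open>q\<close> to the meet at which the two paths are joined.\<close>
  have "expr_mult (expr_of p) (expr_of q) = expr_mult (expr_mult (expr_of p) (ptgt p, [])) (expr_of q)"
    using assms e by (simp add: expr_mult_proj_right path_expr_expr_of expr_tgt_expr_of proj_idem)
  also have "\<dots> = expr_mult (expr_of p) (?h, restr_tail ?h ?w)"
    using assms e by (simp add: expr_mult_assoc path_expr_expr_of expr_mult_Nil t)
  also have "\<dots> = (psrc ?p, snd (expr_of ?p) @ restr_tail ?h ?w)" using c by simp
  also have "\<dots> = expr_of (?p @ ?q)"
    by (rule expr_of_eqI[symmetric]) (use c q in \<open>auto simp: psrc_append paths_nonempty\<close>)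
  finally have e: "expr_mult (expr_of p) (expr_of q) = expr_of (?p @ ?q)" .
  have pq: "?p @ ?q \<in> paths S X" using c q by (simp add: paths_append)
  have "pclass S X p \<otimes>\<^bsub>path_monoid S X\<^esub> pclass S X q = pclass S X (?p @ ?q)"
    using assms h c q
    by (simp add: path_monoid_def csrc_pclass ctgt_pclass class_restr_pclass class_corestr_pclass
        class_comp_pclass)
  also have "\<dots> = pclass S X (expr_path (expr_of (?p @ ?q)))"
    using pq expr_path_paths path_expr_expr_of by (metis pclass_cong)
  finally show ?thesis by (simp add: e)
qed

definition expr_class :: "'s expr \<Rightarrow> 's path set" where
  "expr_class w = pclass S X (expr_path w)"

lemma expr_class_bij: "bij_betw expr_class (carrier expr_monoid) (carrier (path_monoid S X))"
proof (rule bij_betw_imageI)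
  show "inj_on expr_class (carrier expr_monoid)"
  proof (rule inj_onI)
    fix v w assume vw: "v \<in> carrier expr_monoid" "w \<in> carrier expr_monoid"
      "expr_class v = expr_class w"
    then have "expr_path v \<in> pclass S X (expr_path w)"
      using pclass_self[of "expr_path v"] expr_path_paths[of v]
      by (simp add: expr_monoid_def expr_class_def)
    then show "v = w" using vw expr_path_paths by (auto simp: expr_monoid_def pclass_eq)
  qed
  have "pclass S X p \<in> expr_class ` Collect path_expr" if "p \<in> paths S X" for p
  proof (rule image_eqI)
    show "expr_of p \<in> Collect path_expr" using path_expr_expr_of[OF that] by simp
    show "pclass S X p = expr_class (expr_of p)" unfolding expr_class_def
      by (rule pclass_cong) (use that expr_path_paths[OF path_expr_expr_of[OF that]] in auto)
  qed
  moreover have "expr_class w \<in> pclass S X ` paths S X" if "path_expr w" for w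
    using expr_path_paths[OF that] by (simp add: expr_class_def)
  moreover have "carrier (path_monoid S X) = pclass S X ` paths S X"
    by (auto simp: path_monoid_def quotient_def pclass_def)
  ultimately show "expr_class ` carrier expr_monoid = carrier (path_monoid S X)"
    by (auto simp: expr_monoid_def)
qed

end


section \<open>Homomorphisms and quotients in signature (2,1,1,0)\<close>

locale unary_monoid = monoid A for A :: "('a, 'm) ehresmann_scheme" (structure) +
  assumes eplus_closed: "x \<in> carrier A \<Longrightarrow> eplus A x \<in> carrier A"
    and estar_closed: "x \<in> carrier A \<Longrightarrow> estar A x \<in> carrier A"

definition ehr_hom :: "('a, 'm) ehresmann_scheme \<Rightarrow> ('b, 'n) ehresmann_scheme \<Rightarrow> ('a \<Rightarrow> 'b) \<Rightarrow> bool" where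
  "ehr_hom A B f \<longleftrightarrow> f \<in> hom A B \<and> f \<one>\<^bsub>A\<^esub> = \<one>\<^bsub>B\<^esub> \<and>
     (\<forall>x\<in>carrier A. f (eplus A x) = eplus B (f x) \<and> f (estar A x) = estar B (f x))"

text \<open>The diagonal relation arises as the kernel of the identity, so that the axioms of an Ehresmann
  monoid and the axioms modulo a congruence have one formulation, \<open>ehr_identities\<close>.\<close>

definition kernel_rel :: "('a, 'm) ehresmann_scheme \<Rightarrow> ('a \<Rightarrow> 'b) \<Rightarrow> ('a \<times> 'a) set" where
  "kernel_rel A f = {(x, y). x \<in> carrier A \<and> y \<in> carrier A \<and> f x = f y}"

definition ehr_identities :: "('a, 'm) ehresmann_scheme \<Rightarrow> ('a \<times> 'a) set \<Rightarrow> bool" where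
  "ehr_identities A \<theta> \<longleftrightarrow> (\<forall>x\<in>carrier A. \<forall>y\<in>carrier A.
     (eplus A x \<otimes>\<^bsub>A\<^esub> x, x) \<in> \<theta> \<and>
     (eplus A (eplus A x \<otimes>\<^bsub>A\<^esub> eplus A y), eplus A x \<otimes>\<^bsub>A\<^esub> eplus A y) \<in> \<theta> \<and>
     (eplus A x \<otimes>\<^bsub>A\<^esub> eplus A y, eplus A y \<otimes>\<^bsub>A\<^esub> eplus A x) \<in> \<theta> \<and>
     (eplus A (x \<otimes>\<^bsub>A\<^esub> y), eplus A (x \<otimes>\<^bsub>A\<^esub> eplus A y)) \<in> \<theta> \<and>
     (x \<otimes>\<^bsub>A\<^esub> estar A x, x) \<in> \<theta> \<and>
     (estar A (estar A x \<otimes>\<^bsub>A\<^esub> estar A y), estar A x \<otimes>\<^bsub>A\<^esub> estar A y) \<in> \<theta> \<and>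
     (estar A x \<otimes>\<^bsub>A\<^esub> estar A y, estar A y \<otimes>\<^bsub>A\<^esub> estar A x) \<in> \<theta> \<and>
     (estar A (x \<otimes>\<^bsub>A\<^esub> y), estar A (estar A x \<otimes>\<^bsub>A\<^esub> y)) \<in> \<theta> \<and>
     (estar A (eplus A x), eplus A x) \<in> \<theta> \<and>
     (eplus A (estar A x), estar A x) \<in> \<theta>)"

lemma ehr_identities_mono: "\<lbrakk>ehr_identities A \<theta>; \<theta> \<subseteq> \<theta>'\<rbrakk> \<Longrightarrow> ehr_identities A \<theta>'"
  unfolding ehr_identities_def by blast

lemma ehr_homD:
  assumes "ehr_hom A B f"
  shows "x \<in> carrier A \<Longrightarrow> f x \<in> carrier B"
    and "\<lbrakk>x \<in> carrier A; y \<in> carrier A\<rbrakk> \<Longrightarrow> f (x \<otimes>\<^bsub>A\<^esub> y) = f x \<otimes>\<^bsub>B\<^esub> f y"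
    and "f \<one>\<^bsub>A\<^esub> = \<one>\<^bsub>B\<^esub>"
    and "x \<in> carrier A \<Longrightarrow> f (eplus A x) = eplus B (f x)"
    and "x \<in> carrier A \<Longrightarrow> f (estar A x) = estar B (f x)"
  using assms by (auto simp: ehr_hom_def hom_def)

lemma (in ehresmann_monoid) unary_monoid: "unary_monoid S"
  by unfold_locales (auto simp: plus_closed star_closed)

context unary_monoid
begin

lemma kernel_identities:
  assumes "ehr_hom A B f" "ehresmann_monoid B"
  shows "ehr_identities A (kernel_rel A f)"
proof -
  interpret B: ehresmann_monoid B by fact
  note h = ehr_homD[OF assms(1)]
  show ?thesis
    unfolding ehr_identities_def kernel_rel_def
    by (auto simp: eplus_closed estar_closed h B.plus_left B.plus_mult_plus
        B.star_right B.star_mult_star B.star_plus B.plus_star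
        intro: B.plus_comm B.star_comm B.plus_mult B.star_mult)
qed

text \<open>Identities pass to homomorphic images as soon as they hold modulo the kernel.\<close>

lemma surj_hom_ehresmann:
  assumes "ehr_hom A B f" "f ` carrier A = carrier B" "ehr_identities A (kernel_rel A f)"
  shows "ehresmann_monoid B"
proof -
  note h = ehr_homD[OF assms(1)]
  note i = assms(3)[unfolded ehr_identities_def kernel_rel_def]
  have pre: "\<exists>a\<in>carrier A. x = f a" if "x \<in> carrier B" for x using that assms(2) by auto
  show ?thesis
  proof
    fix x assume "x \<in> carrier B"
    then obtain a where a: "a \<in> carrier A" "x = f a" using pre by auto
    show "\<one>\<^bsub>B\<^esub> \<otimes>\<^bsub>B\<^esub> x = x" "x \<otimes>\<^bsub>B\<^esub> \<one>\<^bsub>B\<^esub> = x"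
      using a by (metis h(2,3) l_one one_closed, metis a h(2,3) r_one one_closed)
    show "eplus B x \<in> carrier B" "estar B x \<in> carrier B"
      using a by (metis h(1,4) eplus_closed, metis a h(1,5) estar_closed)
    show "eplus B x \<otimes>\<^bsub>B\<^esub> x = x" "x \<otimes>\<^bsub>B\<^esub> estar B x = x"
      "estar B (eplus B x) = eplus B x" "eplus B (estar B x) = estar B x"
      using i a by (simp_all add: h eplus_closed estar_closed flip: h(2,4,5))
    fix y assume "y \<in> carrier B"
    then obtain b where b: "b \<in> carrier A" "y = f b" using pre by auto
    show "x \<otimes>\<^bsub>B\<^esub> y \<in> carrier B" using a b by (simp add: h flip: h(2))
    have "eplus B (eplus B x \<otimes>\<^bsub>B\<^esub> eplus B y) = eplus B x \<otimes>\<^bsub>B\<^esub> eplus B y \<and>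
        eplus B x \<otimes>\<^bsub>B\<^esub> eplus B y = eplus B y \<otimes>\<^bsub>B\<^esub> eplus B x \<and>
        eplus B (x \<otimes>\<^bsub>B\<^esub> y) = eplus B (x \<otimes>\<^bsub>B\<^esub> eplus B y) \<and>
        estar B (estar B x \<otimes>\<^bsub>B\<^esub> estar B y) = estar B x \<otimes>\<^bsub>B\<^esub> estar B y \<and>
        estar B x \<otimes>\<^bsub>B\<^esub> estar B y = estar B y \<otimes>\<^bsub>B\<^esub> estar B x \<and>
        estar B (x \<otimes>\<^bsub>B\<^esub> y) = estar B (estar B x \<otimes>\<^bsub>B\<^esub> y)"
      unfolding a(2) b(2) using i[rule_format, OF a(1) b(1)]
      by (simp (no_asm_use) add: a(1) b(1) h eplus_closed estar_closed; blast)
    then show "eplus B (eplus B x \<otimes>\<^bsub>B\<^esub> eplus B y) = eplus B x \<otimes>\<^bsub>B\<^esub> eplus B y"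
      "eplus B x \<otimes>\<^bsub>B\<^esub> eplus B y = eplus B y \<otimes>\<^bsub>B\<^esub> eplus B x"
      "eplus B (x \<otimes>\<^bsub>B\<^esub> y) = eplus B (x \<otimes>\<^bsub>B\<^esub> eplus B y)"
      "estar B (estar B x \<otimes>\<^bsub>B\<^esub> estar B y) = estar B x \<otimes>\<^bsub>B\<^esub> estar B y"
      "estar B x \<otimes>\<^bsub>B\<^esub> estar B y = estar B y \<otimes>\<^bsub>B\<^esub> estar B x"
      "estar B (x \<otimes>\<^bsub>B\<^esub> y) = estar B (estar B x \<otimes>\<^bsub>B\<^esub> y)"
      by blast+
    fix z assume "z \<in> carrier B"
    then obtain c where c: "c \<in> carrier A" "z = f c" using pre by auto
    show "x \<otimes>\<^bsub>B\<^esub> y \<otimes>\<^bsub>B\<^esub> z = x \<otimes>\<^bsub>B\<^esub> (y \<otimes>\<^bsub>B\<^esub> z)"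
      using a b c by (simp add: m_assoc flip: h(2))
  next
    show "\<one>\<^bsub>B\<^esub> \<in> carrier B" by (metis h(1,3) one_closed)
  qed
qed

lemma quot_hom:
  assumes "monoid_cong A \<theta>" "unary_compatible A \<theta>"
  shows "ehr_hom A (ehr_quot A \<theta>) (\<lambda>a. \<theta> `` {a})"
    and "(\<lambda>a. \<theta> `` {a}) ` carrier A = carrier (ehr_quot A \<theta>)"
    and "kernel_rel A (\<lambda>a. \<theta> `` {a}) = \<theta>"
proof -
  have eq: "equiv (carrier A) \<theta>" using assms by (simp add: monoid_cong_def)
  have self: "a \<in> \<theta> `` {a}" if "a \<in> carrier A" for a
    by (rule equiv_class_self[OF eq that])
  have cl: "\<theta> `` {a} = \<theta> `` {b}" if "(a, b) \<in> \<theta>" for a b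
    using equiv_class_eq[OF eq that] .
  have "(\<Union>a'\<in>\<theta> `` {a}. \<Union>b'\<in>\<theta> `` {b}. \<theta> `` {a' \<otimes> b'}) = \<theta> `` {a \<otimes> b}"
    if "a \<in> carrier A" "b \<in> carrier A" for a b
  proof -
    have "\<theta> `` {a' \<otimes> b'} = \<theta> `` {a \<otimes> b}" if "a' \<in> \<theta> `` {a}" "b' \<in> \<theta> `` {b}" for a' b'
      using that assms(1) cl[of "a \<otimes> b" "a' \<otimes> b'"] by (auto simp: monoid_cong_def)
    then show ?thesis
      using that by (intro UN_constant_eq[OF self[of a]] UN_constant_eq[OF self[of b]] ballI)
  qed
  moreover have "(\<Union>a'\<in>\<theta> `` {a}. \<theta> `` {F a'}) = \<theta> `` {F a}"
    if "a \<in> carrier A" "F = eplus A \<or> F = estar A" for a F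
  proof -
    have "\<theta> `` {F a'} = \<theta> `` {F a}" if "a' \<in> \<theta> `` {a}" for a'
      using that assms(2) cl[of "F a" "F a'"] \<open>F = eplus A \<or> F = estar A\<close>
      by (auto simp: unary_compatible_def)
    then show ?thesis using that by (intro UN_constant_eq[OF self[of a]] ballI)
  qed
  ultimately show "ehr_hom A (ehr_quot A \<theta>) (\<lambda>a. \<theta> `` {a})"
    by (auto simp: ehr_hom_def hom_def ehr_quot_def quotientI)
  show "(\<lambda>a. \<theta> `` {a}) ` carrier A = carrier (ehr_quot A \<theta>)"
    by (auto simp: ehr_quot_def quotient_def)
  show "kernel_rel A (\<lambda>a. \<theta> `` {a}) = \<theta>"
  proof -
    have "(a, b) \<in> kernel_rel A (\<lambda>a. \<theta> `` {a}) \<longleftrightarrow> (a, b) \<in> \<theta>" for a b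
      unfolding kernel_rel_def mem_Collect_eq prod.case
      using eq_equiv_class_iff[OF eq, of a b] equiv_type[OF eq] by blast
    then show ?thesis by auto
  qed
qed

text \<open>Since a congruence is the kernel of its own quotient map, the quotient is Ehresmann precisely if
  the identities hold modulo the congruence. This is a condition closed under intersection.\<close>

lemma ehr_cong_iff:
  "ehr_cong A \<theta> \<longleftrightarrow> monoid_cong A \<theta> \<and> unary_compatible A \<theta> \<and> ehr_identities A \<theta>"
proof (cases "monoid_cong A \<theta> \<and> unary_compatible A \<theta>")
  case True
  then have q: "monoid_cong A \<theta>" "unary_compatible A \<theta>" by auto
  show ?thesis
    using q kernel_identities[OF quot_hom(1)[OF q]] surj_hom_ehresmann[OF quot_hom(1,2)[OF q]]
    by (auto simp: ehr_cong_def quot_hom(3)[OF q])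
qed (auto simp: ehr_cong_def)

lemma kernel_ehr_cong:
  assumes "ehr_hom A B f" "ehresmann_monoid B"
  shows "ehr_cong A (kernel_rel A f)"
proof -
  note h = ehr_homD[OF assms(1)]
  have "equiv (carrier A) (kernel_rel A f)"
    by (auto simp: kernel_rel_def equiv_def refl_on_def sym_def trans_def)
  then show ?thesis
    using kernel_identities[OF assms]
    by (auto simp: ehr_cong_iff monoid_cong_def unary_compatible_def kernel_rel_def h
        eplus_closed estar_closed)
qed

text \<open>An Ehresmann congruence \<open>\<theta>\<^sub>0\<close> has to be given because the intersection of the empty family
  would be the universal relation on the whole type, which need not be contained in the square of
  the carrier.\<close>

lemma min_ehr_cong:
  assumes "ehr_cong A \<theta>\<^sub>0"
  shows "ehr_cong A (min_ehr_cong A)"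
proof -
  let ?C = "{\<theta>. ehr_cong A \<theta>}"
  have C: "equiv (carrier A) \<theta>" "monoid_cong A \<theta>" "unary_compatible A \<theta>" "ehr_identities A \<theta>"
    if "ehr_cong A \<theta>" for \<theta> using that by (auto simp: ehr_cong_iff monoid_cong_def)
  have "equiv (carrier A) (\<Inter> ?C)"
  proof (rule equivI)
    show "\<Inter> ?C \<subseteq> carrier A \<times> carrier A" using equiv_type[OF C(1)[OF assms]] assms by blast
    show "refl_on (carrier A) (\<Inter> ?C)" using C(1) by (auto simp: equiv_def refl_on_def)
    show "sym (\<Inter> ?C)" using C(1) by (auto simp: equiv_def intro!: symI dest: symD)
    show "trans (\<Inter> ?C)"
    proof (rule transI, rule InterI)
      fix a b c \<theta> assume "(a, b) \<in> \<Inter> ?C" "(b, c) \<in> \<Inter> ?C" and \<theta>: "\<theta> \<in> ?C"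
      then have "(a, b) \<in> \<theta>" "(b, c) \<in> \<theta>" by blast+
      then show "(a, c) \<in> \<theta>" using C(1) \<theta> by (auto simp: equiv_def dest: transD)
    qed
  qed
  moreover have "(a \<otimes> c, b \<otimes> d) \<in> \<Inter> ?C" if "(a, b) \<in> \<Inter> ?C" "(c, d) \<in> \<Inter> ?C" for a b c d
  proof
    fix \<theta> assume \<theta>: "\<theta> \<in> ?C"
    then have "(a, b) \<in> \<theta>" "(c, d) \<in> \<theta>" using that by blast+
    then show "(a \<otimes> c, b \<otimes> d) \<in> \<theta>" using C(2) \<theta> by (simp add: monoid_cong_def)
  qed
  moreover have "unary_compatible A (\<Inter> ?C)"
    using C(3) unfolding unary_compatible_def by blast
  moreover have "ehr_identities A (\<Inter> ?C)"
    using C(4) unfolding ehr_identities_def by blast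
  ultimately show ?thesis by (simp add: ehr_cong_iff min_ehr_cong_def monoid_cong_def)
qed

lemma min_ehr_cong_least: "ehr_cong A \<theta> \<Longrightarrow> min_ehr_cong A \<subseteq> \<theta>"
  by (auto simp: min_ehr_cong_def)

end

section \<open>The monoid of classes of paths\<close>

context ehr_letters
begin

lemma expr_class_hom: "ehr_hom expr_monoid (path_monoid S X) expr_class"
proof -
  have src: "psrc (expr_path w) = fst w" and tgt: "ptgt (expr_path w) = expr_tgt w"
    if "path_expr w" for w
    using expr_path_paths[OF that] by (metis fst_expr_of, metis expr_tgt_expr_of)
  have "expr_class (expr_mult v w) = expr_class v \<otimes>\<^bsub>path_monoid S X\<^esub> expr_class w"
    if "path_expr v" "path_expr w" for v w
    using expr_path_paths[OF that(1)] expr_path_paths[OF that(2)]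
    by (simp add: expr_class_def path_monoid_mult)
  moreover have "expr_class (fst w, []) = eplus (path_monoid S X) (expr_class w)"
    "expr_class (expr_tgt w, []) = estar (path_monoid S X) (expr_class w)" if "path_expr w" for w
    using expr_path_paths[OF that] src[OF that] tgt[OF that]
    by (simp_all add: expr_class_def path_monoid_def csrc_pclass ctgt_pclass)
  moreover have "expr_class (\<one>, []) = \<one>\<^bsub>path_monoid S X\<^esub>"
    by (simp add: expr_class_def path_monoid_def)
  ultimately show ?thesis
    using bij_betwE[OF expr_class_bij] by (auto simp: ehr_hom_def hom_def expr_monoid_def)
qed

lemma path_monoid_ehresmann: "ehresmann_monoid (path_monoid S X)"
proof -
  interpret N: ehresmann_monoid expr_monoid by (rule expr_monoid_ehresmann)
  interpret N: unary_monoid expr_monoid by (rule N.unary_monoid)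
  have "ehr_hom expr_monoid expr_monoid id" by (auto simp: ehr_hom_def hom_def)
  from N.kernel_identities[OF this expr_monoid_ehresmann]
  have "ehr_identities expr_monoid (kernel_rel expr_monoid expr_class)"
    by (rule ehr_identities_mono) (auto simp: kernel_rel_def)
  with expr_class_hom bij_betw_imp_surj_on[OF expr_class_bij] show ?thesis
    by (rule N.surj_hom_ehresmann)
qed


section \<open>From the free product to path expressions\<close>

text \<open>Words over the free product act by composing the actions of letters and projections; the word is
  recovered, up to the Ehresmann congruence, from its effect on the expression \<open>1\<close>.\<close>

fun fp_act :: "'s list + 's \<Rightarrow> 's expr \<Rightarrow> 's expr" where
  "fp_act (Inl t) p = foldr letter_act t p"
| "fp_act (Inr e) p = proj_act e p"

definition word_act :: "'s fpword \<Rightarrow> 's expr \<Rightarrow> 's expr" where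
  "word_act u p = foldr fp_act u p"

definition word_expr :: "'s fpword \<Rightarrow> 's expr" where
  "word_expr u = word_act u (\<one>, [])"

lemma word_act_simps [simp]:
  "word_act [] p = p"
  "word_act (a # u) p = fp_act a (word_act u p)"
  "word_act (u @ v) p = word_act u (word_act v p)"
  by (simp_all add: word_act_def)

lemma fpwords_simps [simp]:
  "[] \<in> fpwords S X"
  "a # u \<in> fpwords S X \<longleftrightarrow> a \<in> lists X <+> projs S \<and> u \<in> fpwords S X"
  "u @ v \<in> fpwords S X \<longleftrightarrow> u \<in> fpwords S X \<and> v \<in> fpwords S X"
  by (auto simp: fpwords_def)

lemma Plus_simps [simp]: "Inl a \<in> A <+> B \<longleftrightarrow> a \<in> A" "Inr b \<in> A <+> B \<longleftrightarrow> b \<in> B"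
  by auto

lemma letters_act_closed: "\<lbrakk>t \<in> lists X; path_expr p\<rbrakk> \<Longrightarrow> path_expr (foldr letter_act t p)"
  by (induction t) (auto simp: letter_act_closed)

lemma fp_act_closed: "\<lbrakk>a \<in> lists X <+> projs S; path_expr p\<rbrakk> \<Longrightarrow> path_expr (fp_act a p)"
  by (cases a) (simp_all add: letters_act_closed proj_act_closed)

lemma word_act_closed: "\<lbrakk>u \<in> fpwords S X; path_expr p\<rbrakk> \<Longrightarrow> path_expr (word_act u p)"
  by (induction u) (auto simp: fp_act_closed simp del: fp_act.simps)

lemma word_expr_closed: "u \<in> fpwords S X \<Longrightarrow> path_expr (word_expr u)"
  by (simp add: word_expr_def word_act_closed one_in_projs)

text \<open>The relations of the free product only concern concatenation of words in \<open>X\<^sup>*\<close>, products of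
  projections and the unit, and all of these are respected by the actions.\<close>

lemma fp_cong_word_act:
  "(u, v) \<in> fp_cong S X \<Longrightarrow> u \<in> fpwords S X \<and> v \<in> fpwords S X \<and>
     (\<forall>p. path_expr p \<longrightarrow> word_act u p = word_act v p)"
proof (induction rule: fp_cong.induct)
  case (append u v u' v')
  then show ?case by (simp del: split_paired_All add: word_act_closed)
qed (auto simp: proj_act_mult proj_mult_closed proj_act_one one_in_projs)

lemma letters_expr_mult:
  "\<lbrakk>t \<in> lists X; path_expr p; path_expr q\<rbrakk>
    \<Longrightarrow> expr_mult (foldr letter_act t p) q = foldr letter_act t (expr_mult p q)"
  by (induction t) (auto simp: letter_act_expr_mult letters_act_closed)

lemma fp_act_expr_mult:
  "\<lbrakk>a \<in> lists X <+> projs S; path_expr p; path_expr q\<rbrakk>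
    \<Longrightarrow> expr_mult (fp_act a p) q = fp_act a (expr_mult p q)"
  by (cases a) (simp_all add: letters_expr_mult proj_act_expr_mult)

lemma word_act_expr_mult:
  "\<lbrakk>u \<in> fpwords S X; path_expr p; path_expr q\<rbrakk>
    \<Longrightarrow> expr_mult (word_act u p) q = word_act u (expr_mult p q)"
  by (induction u) (auto simp: fp_act_expr_mult word_act_closed simp del: fp_act.simps)

lemma word_expr_append:
  assumes "u \<in> fpwords S X" "v \<in> fpwords S X"
  shows "word_expr (u @ v) = expr_mult (word_expr u) (word_expr v)"
  using assms word_expr_closed[OF assms(2)]
  by (simp add: word_expr_def word_act_expr_mult one_in_projs expr_mult_Nil proj_act_one)

lemma wval_simps [simp]: "wval S [] = \<one>" "wval S (x # t) = x \<otimes> wval S t"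
  by (simp_all add: wval_def)

lemma wval_closed: "t \<in> lists X \<Longrightarrow> wval S t \<in> carrier S"
  by (induction t) (auto simp: letter_carrier)

lemma letters_act_src:
  "\<lbrakk>t \<in> lists X; e \<in> projs S; fst p = e\<rbrakk> \<Longrightarrow> fst (foldr letter_act t p) = eplus S (wval S t \<otimes> e)"
proof (induction t)
  case Nil
  then show ?case by (simp add: plus_proj projs_carrier)
next
  case (Cons x t)
  then have c: "x \<in> carrier S" "wval S t \<in> carrier S" "e \<in> carrier S"
    by (auto simp: letter_carrier projs_carrier wval_closed)
  then have "eplus S (x \<otimes> eplus S (wval S t \<otimes> e)) = eplus S (x \<otimes> (wval S t \<otimes> e))"
    by (metis m_closed plus_mult)
  then show ?case using Cons c by (simp add: letter_act_def m_assoc)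
qed

text \<open>Since the actions keep track of the first vertex in the way in which \<open>X\<^sup>*\<close> and \<open>P(S)\<close> act on
  \<open>P(S)\<close> from the left, the value \<open>u\<^sup>+ = u \<cdot> 1\<close> can be read off from the expression produced by \<open>u\<close>.\<close>

lemma word_act_src:
  "\<lbrakk>u \<in> fpwords S X; path_expr p\<rbrakk> \<Longrightarrow> foldr (lact1 S) u (fst p) = fst (word_act u p)"
proof (induction u)
  case (Cons a u)
  then have "path_expr (word_act u p)" by (simp add: word_act_closed)
  then show ?case using Cons path_expr_src[of "word_act u p"]
    by (cases a) (simp_all add: letters_act_src proj_act_def)
qed simp

lemma letters_act_tgt:
  "\<lbrakk>t \<in> lists X; g \<in> projs S; path_expr p\<rbrakk> \<Longrightarrow>
    expr_tgt (proj_act g (foldr letter_act t p)) = expr_tgt (proj_act (estar S (g \<otimes> wval S t)) p)"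
proof (induction t arbitrary: g)
  case Nil
  then show ?case by (simp add: star_proj projs_carrier)
next
  case (Cons x t)
  then have c: "x \<in> carrier S" "wval S t \<in> carrier S" "g \<in> carrier S"
    by (auto simp: letter_carrier projs_carrier wval_closed)
  then have "estar S (estar S (g \<otimes> x) \<otimes> wval S t) = estar S (g \<otimes> (x \<otimes> wval S t))"
    by (metis m_assoc m_closed star_mult)
  then show ?case using Cons c
    by (simp add: proj_letter_act_tgt letters_act_closed star_in_projs)
qed

text \<open>The counterpart for the right action: \<open>g\<close> is moved through the word by \<open>proj_letter_act_tgt\<close>,
  one letter at a time. The case \<open>g = 1\<close> identifies \<open>u\<^sup>* = 1 \<circ> u\<close> with the last vertex.\<close>

lemma word_act_tgt:
  "\<lbrakk>u \<in> fpwords S X; g \<in> projs S; path_expr p\<rbrakk> \<Longrightarrow> foldl (ract1 S) g u \<in> projs S \<and>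
    expr_tgt (proj_act g (word_act u p)) = expr_tgt (proj_act (foldl (ract1 S) g u) p)"
proof (induction u arbitrary: g)
  case (Cons a u)
  then have p: "path_expr (word_act u p)" by (simp add: word_act_closed)
  have "ract1 S g a \<in> projs S \<and>
      expr_tgt (proj_act g (fp_act a (word_act u p))) = expr_tgt (proj_act (ract1 S g a) (word_act u p))"
  proof (cases a)
    case (Inl t)
    then show ?thesis using Cons.prems p
      by (simp add: letters_act_tgt star_in_projs wval_closed projs_carrier)
  next
    case (Inr e)
    then show ?thesis using Cons.prems p by (auto simp: proj_act_mult proj_mult_closed)
  qed
  then show ?case using Cons by simp
qed simp

lemma fpclass_self: "u \<in> fpwords S X \<Longrightarrow> u \<in> fpclass S X u"
  by (simp add: fpclass_def fp_cong.refl)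

lemma fpclass_cong: "(u, v) \<in> fp_cong S X \<Longrightarrow> fpclass S X u = fpclass S X v"
  by (auto simp: fpclass_def intro: fp_cong.sym fp_cong.trans)

lemma lact_fpclass:
  assumes "u \<in> fpwords S X"
  shows "lact S (fpclass S X u) \<one> = fst (word_expr u)"
  unfolding lact_def
proof (rule the_elem_image_unique)
  show "fpclass S X u \<noteq> {}" using fpclass_self[OF assms] by auto
  fix v assume "v \<in> fpclass S X u"
  then have "v \<in> fpwords S X" "word_expr u = word_expr v"
    using fp_cong_word_act[of u v] one_in_projs by (auto simp: fpclass_def word_expr_def)
  then show "foldr (lact1 S) v \<one> = fst (word_expr u)"
    using word_act_src[of v "(\<one>, [])"] by (simp add: word_expr_def one_in_projs)
qed

lemma ract_fpclass:
  assumes "u \<in> fpwords S X"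
  shows "ract S \<one> (fpclass S X u) = expr_tgt (word_expr u)"
  unfolding ract_def
proof (rule the_elem_image_unique)
  show "fpclass S X u \<noteq> {}" using fpclass_self[OF assms] by auto
  fix v assume "v \<in> fpclass S X u"
  then have v: "v \<in> fpwords S X" "word_expr u = word_expr v"
    using fp_cong_word_act[of u v] one_in_projs by (auto simp: fpclass_def word_expr_def)
  let ?e = "foldl (ract1 S) \<one> v"
  have "?e \<in> projs S" "expr_tgt (proj_act \<one> (word_expr v)) = expr_tgt (proj_act ?e (\<one>, []))"
    using word_act_tgt[of v \<one> "(\<one>, [])"] v one_in_projs by (auto simp: word_expr_def)
  then show "?e = expr_tgt (word_expr u)"
    using v word_expr_closed[OF v(1)]
    by (simp add: proj_act_one) (simp add: proj_act_def expr_tgt_def projs_carrier)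
qed

lemma free_prod_carrier: "carrier (free_prod S X) = fpclass S X ` fpwords S X"
  by (auto simp: free_prod_def quotient_def fpclass_def)

lemma free_prod_mult:
  assumes "u \<in> fpwords S X" "v \<in> fpwords S X"
  shows "fpclass S X u \<otimes>\<^bsub>free_prod S X\<^esub> fpclass S X v = fpclass S X (u @ v)"
proof -
  have "fpclass S X (u' @ v') = fpclass S X (u @ v)"
    if "u' \<in> fpclass S X u" "v' \<in> fpclass S X v" for u' v'
    using that by (intro fpclass_cong fp_cong.append) (auto simp: fpclass_def intro: fp_cong.sym)
  then show ?thesis
    unfolding free_prod_def monoid.simps
    by (intro UN_constant_eq[OF fpclass_self[OF assms(1)]] UN_constant_eq[OF fpclass_self[OF assms(2)]] ballI)
qed

lemma free_prod_unary:
  assumes "u \<in> fpwords S X"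
  shows "eplus (free_prod S X) (fpclass S X u) = fpclass S X [Inr (fst (word_expr u))]"
    and "estar (free_prod S X) (fpclass S X u) = fpclass S X [Inr (expr_tgt (word_expr u))]"
  using assms by (simp_all add: free_prod_def lact_fpclass ract_fpclass)

lemma free_prod_one: "\<one>\<^bsub>free_prod S X\<^esub> = fpclass S X []"
  by (simp add: free_prod_def)

lemma word_expr_projs:
  assumes "u \<in> fpwords S X"
  shows "fst (word_expr u) \<in> projs S" "expr_tgt (word_expr u) \<in> projs S"
  using word_expr_closed[OF assms] path_expr_src path_expr_tgt by auto

lemma free_prod_unary_monoid: "unary_monoid (free_prod S X)"
  by unfold_locales
    (auto simp: free_prod_carrier free_prod_mult free_prod_one free_prod_unary word_expr_projs)

definition class_expr :: "'s fpword set \<Rightarrow> 's expr" where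
  "class_expr c = the_elem (word_expr ` c)"

lemma class_expr_fpclass:
  assumes "u \<in> fpwords S X"
  shows "class_expr (fpclass S X u) = word_expr u"
  unfolding class_expr_def
proof (rule the_elem_image_unique)
  show "fpclass S X u \<noteq> {}" using fpclass_self[OF assms] by auto
  show "word_expr v = word_expr u" if "v \<in> fpclass S X u" for v
    using that fp_cong_word_act[of u v] one_in_projs by (auto simp: fpclass_def word_expr_def)
qed

lemma word_expr_proj: "e \<in> projs S \<Longrightarrow> word_expr [Inr e] = (e, [])"
  by (simp add: word_expr_def proj_act_def projs_carrier)

text \<open>Supplies the Ehresmann congruence that the minimum congruence needs, and makes the minimum congruence
  small enough to separate the path expressions.\<close>

lemma class_expr_hom: "ehr_hom (free_prod S X) expr_monoid class_expr"
proof -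
  have "word_expr [] = (\<one>, [])" by (simp add: word_expr_def)
  then show ?thesis
    by (auto simp: ehr_hom_def hom_def free_prod_carrier free_prod_mult free_prod_one free_prod_unary
        class_expr_fpclass word_expr_append word_expr_projs word_expr_proj word_expr_closed
        expr_monoid_def)
qed


section \<open>Canonical forms in the quotient\<close>

definition word_val :: "'s fpword \<Rightarrow> 's fpword set set" where
  "word_val u = min_ehr_cong (free_prod S X) `` {fpclass S X u}"

lemma min_ehr_cong_free_prod: "ehr_cong (free_prod S X) (min_ehr_cong (free_prod S X))"
proof -
  interpret F: unary_monoid "free_prod S X" by (rule free_prod_unary_monoid)
  show ?thesis
    by (rule F.min_ehr_cong[OF F.kernel_ehr_cong[OF class_expr_hom expr_monoid_ehresmann]])
qed

lemma BGG_ehresmann: "ehresmann_monoid (BGG S X)"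
  using min_ehr_cong_free_prod by (simp add: ehr_cong_def BGG_def)

lemma quot_map_hom:
  "ehr_hom (free_prod S X) (BGG S X) (\<lambda>c. min_ehr_cong (free_prod S X) `` {c})"
  "(\<lambda>c. min_ehr_cong (free_prod S X) `` {c}) ` carrier (free_prod S X) = carrier (BGG S X)"
  using min_ehr_cong_free_prod unary_monoid.quot_hom[OF free_prod_unary_monoid]
  by (auto simp: ehr_cong_def BGG_def)

lemma BGG_carrier: "carrier (BGG S X) = word_val ` fpwords S X"
  using quot_map_hom(2) by (simp add: free_prod_carrier image_image word_val_def)

lemma word_val_closed: "u \<in> fpwords S X \<Longrightarrow> word_val u \<in> carrier (BGG S X)"
  by (simp add: BGG_carrier)

lemma word_val_append:
  "\<lbrakk>u \<in> fpwords S X; v \<in> fpwords S X\<rbrakk> \<Longrightarrow> word_val (u @ v) = word_val u \<otimes>\<^bsub>BGG S X\<^esub> word_val v"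
  using ehr_homD(2)[OF quot_map_hom(1), of "fpclass S X u" "fpclass S X v"]
  by (simp add: free_prod_carrier free_prod_mult word_val_def)

lemma word_val_one: "word_val [] = \<one>\<^bsub>BGG S X\<^esub>"
  using ehr_homD(3)[OF quot_map_hom(1)] by (simp add: free_prod_one word_val_def)

lemma emb_word_val: "emb_proj S X e = word_val [Inr e]" "emb_letter S X x = word_val [Inl [x]]"
  by (simp_all add: emb_proj_def emb_letter_def word_val_def)

lemma word_val_unary:
  assumes "u \<in> fpwords S X"
  shows "eplus (BGG S X) (word_val u) = emb_proj S X (fst (word_expr u))"
    and "estar (BGG S X) (word_val u) = emb_proj S X (expr_tgt (word_expr u))"
  using ehr_homD(4,5)[OF quot_map_hom(1), of "fpclass S X u"] assms
  by (simp_all add: free_prod_carrier free_prod_unary emb_proj_def word_val_def)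

lemma word_val_cong: "(u, v) \<in> fp_cong S X \<Longrightarrow> word_val u = word_val v"
  by (simp add: word_val_def fpclass_cong)

definition BGG_expr :: "'s fpword set set \<Rightarrow> 's expr" where
  "BGG_expr C = the_elem (class_expr ` C)"

lemma BGG_expr_word_val:
  assumes "u \<in> fpwords S X"
  shows "BGG_expr (word_val u) = word_expr u"
  unfolding BGG_expr_def
proof (rule the_elem_image_unique)
  interpret F: unary_monoid "free_prod S X" by (rule free_prod_unary_monoid)
  have "equiv (carrier (free_prod S X)) (min_ehr_cong (free_prod S X))"
    using min_ehr_cong_free_prod by (simp add: ehr_cong_def monoid_cong_def)
  moreover have "fpclass S X u \<in> carrier (free_prod S X)" using assms by (simp add: free_prod_carrier)
  ultimately have "fpclass S X u \<in> word_val u" unfolding word_val_def by (rule equiv_class_self)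
  then show "word_val u \<noteq> {}" by auto
  fix c assume "c \<in> word_val u"
  then have "(fpclass S X u, c) \<in> kernel_rel (free_prod S X) class_expr"
    using F.min_ehr_cong_least[OF F.kernel_ehr_cong[OF class_expr_hom expr_monoid_ehresmann]]
    by (auto simp: word_val_def)
  then show "class_expr c = word_expr u" using assms by (simp add: kernel_rel_def class_expr_fpclass)
qed

lemma BGG_expr_mult:
  assumes "C \<in> carrier (BGG S X)" "D \<in> carrier (BGG S X)"
  shows "BGG_expr (C \<otimes>\<^bsub>BGG S X\<^esub> D) = expr_mult (BGG_expr C) (BGG_expr D)"
  using assms
  by (auto simp: BGG_carrier BGG_expr_word_val word_expr_append simp flip: word_val_append)

lemma BGG_expr_emb_proj: "e \<in> projs S \<Longrightarrow> BGG_expr (emb_proj S X e) = (e, [])"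
  by (auto simp: emb_word_val BGG_expr_word_val word_expr_proj)

lemma BGG_expr_emb_letter: "x \<in> X \<Longrightarrow> BGG_expr (emb_letter S X x) = letter_act x (\<one>, [])"
  by (auto simp: emb_word_val BGG_expr_word_val) (simp add: word_expr_def)

lemma emb_closed:
  "e \<in> projs S \<Longrightarrow> emb_proj S X e \<in> carrier (BGG S X)"
  "x \<in> X \<Longrightarrow> emb_letter S X x \<in> carrier (BGG S X)"
  by (auto simp: emb_word_val intro!: word_val_closed)

lemma emb_proj_mult:
  "\<lbrakk>e \<in> projs S; f \<in> projs S\<rbrakk> \<Longrightarrow> emb_proj S X e \<otimes>\<^bsub>BGG S X\<^esub> emb_proj S X f = emb_proj S X (e \<otimes> f)"
  using word_val_append[of "[Inr e]" "[Inr f]"] word_val_cong[OF fp_cong.mult_right]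
  by (auto simp: emb_word_val)

text \<open>In the quotient, \<open>(e x f)\<^sup>+\<close> and \<open>(e x f)\<^sup>*\<close> are computed by the actions on \<open>P(S)\<close> and therefore
  agree with the values in \<open>S\<close>.\<close>

lemma emb_edge:
  assumes "e \<in> projs S" "x \<in> X" "f \<in> projs S"
  defines "u \<equiv> emb_proj S X e \<otimes>\<^bsub>BGG S X\<^esub> emb_letter S X x \<otimes>\<^bsub>BGG S X\<^esub> emb_proj S X f"
  shows "eplus (BGG S X) u = emb_proj S X (eplus S (e \<otimes> x \<otimes> f))"
    and "estar (BGG S X) u = emb_proj S X (estar S (e \<otimes> x \<otimes> f))"
proof -
  let ?v = "[Inr e, Inl [x], Inr f]"
  have v: "?v \<in> fpwords S X" using assms by auto
  have "u = word_val ?v"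
    using assms word_val_append[of "[Inr e]" "[Inl [x]]"] word_val_append[of "[Inr e, Inl [x]]" "[Inr f]"]
    by (auto simp: u_def emb_word_val)
  moreover have "word_expr ?v = proj_act e (letter_act x (f, []))"
    using assms by (simp add: word_expr_def proj_act_def[of f] projs_carrier)
  ultimately show "eplus (BGG S X) u = emb_proj S X (eplus S (e \<otimes> x \<otimes> f))"
    "estar (BGG S X) u = emb_proj S X (estar S (e \<otimes> x \<otimes> f))"
    using assms word_val_unary[OF v] by (simp_all add: proj_letter_act expr_tgt_def)
qed

lemma emb_proj_one: "emb_proj S X \<one> = \<one>\<^bsub>BGG S X\<^esub>"
  using word_val_cong[OF fp_cong.one_right] by (simp add: emb_word_val word_val_one)

text \<open>Edges of the graph give canonical expressions by \<open>emb_edge\<close>. The converse needs that \<open>P(S)\<close>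
  embeds into the quotient, which is seen by mapping to path expressions.\<close>

lemma canonical_iff_path_expr: "canonical S X w \<longleftrightarrow> path_expr w"
proof (induction w rule: path_expr.induct)
  case (2 e x f w)
  have inj: "emb_proj S X g = emb_proj S X h \<longleftrightarrow> g = h" if "g \<in> projs S" "h \<in> projs S" for g h
    using that BGG_expr_emb_proj by (metis fst_conv)
  have f: "f \<in> projs S" if "path_expr (f, w)" using path_expr_src[OF that] by simp
  have "eplus S (e \<otimes> x \<otimes> f) \<in> projs S" "estar S (e \<otimes> x \<otimes> f) \<in> projs S"
    if "e \<in> projs S" "x \<in> X" "f \<in> projs S"
    using that by (auto intro!: plus_in_projs star_in_projs simp: letter_carrier projs_carrier)
  then show ?case using 2 f by (auto simp: Let_def letter_edge_iff emb_edge inj)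
qed simp

lemma expr_val_closed: "path_expr w \<Longrightarrow> expr_val S X w \<in> carrier (BGG S X)"
proof (induction w rule: path_expr.induct)
  case (2 e x f w)
  interpret B: ehresmann_monoid "BGG S X" by (rule BGG_ehresmann)
  show ?case using 2 by (auto simp: letter_edge_iff emb_closed)
qed (simp add: emb_closed)

text \<open>Uniqueness of canonical forms: the value of an expression in the quotient, sent back to path
  expressions, is the expression itself.\<close>

lemma BGG_expr_expr_val: "path_expr w \<Longrightarrow> BGG_expr (expr_val S X w) = w"
proof (induction w rule: path_expr.induct)
  case (2 e x f w)
  interpret B: ehresmann_monoid "BGG S X" by (rule BGG_ehresmann)
  have c: "e \<in> projs S" "x \<in> X" "path_expr (f, w)" "expr_val S X (f, w) \<in> carrier (BGG S X)"
    using 2 expr_val_closed by (auto simp: letter_edge_iff)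
  have l: "path_expr (letter_act x (\<one>, []))" using c by (simp add: letter_act_closed one_in_projs)
  have "BGG_expr (expr_val S X (e, (x, f) # w)) =
      expr_mult (expr_mult (e, []) (letter_act x (\<one>, []))) (f, w)"
    using 2 c by (simp add: BGG_expr_mult emb_closed BGG_expr_emb_proj BGG_expr_emb_letter)
  also have "\<dots> = proj_act e (letter_act x (f, w))"
    using c l by (simp add: expr_mult_Nil proj_act_expr_mult letter_act_expr_mult one_in_projs
        proj_act_one)
  also have "\<dots> = (e, (x, f) # w)" using 2 by (simp add: edge_act_self)
  finally show ?case .
qed (simp add: BGG_expr_emb_proj)

lemma emb_src_expr_val:
  assumes "path_expr (e, w)"
  shows "emb_proj S X e \<otimes>\<^bsub>BGG S X\<^esub> expr_val S X (e, w) = expr_val S X (e, w)"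
proof -
  interpret B: ehresmann_monoid "BGG S X" by (rule BGG_ehresmann)
  have e: "e \<in> projs S" using path_expr_src[OF assms] by simp
  then have "emb_proj S X e \<otimes>\<^bsub>BGG S X\<^esub> emb_proj S X e = emb_proj S X e"
    by (simp add: emb_proj_mult proj_idem)
  then show ?thesis using assms e
    by (cases w) (auto simp: emb_closed expr_val_closed letter_edge_iff B.m_assoc[symmetric])
qed

lemma emb_letter_star:
  assumes "g \<in> projs S" "x \<in> X"
  shows "emb_proj S X g \<otimes>\<^bsub>BGG S X\<^esub> emb_letter S X x \<otimes>\<^bsub>BGG S X\<^esub> emb_proj S X (estar S (g \<otimes> x)) =
    emb_proj S X g \<otimes>\<^bsub>BGG S X\<^esub> emb_letter S X x"
proof -
  interpret B: ehresmann_monoid "BGG S X" by (rule BGG_ehresmann)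
  let ?u = "emb_proj S X g \<otimes>\<^bsub>BGG S X\<^esub> emb_letter S X x"
  have "?u \<in> carrier (BGG S X)" using assms by (simp add: emb_closed)
  moreover have "estar (BGG S X) ?u = emb_proj S X (estar S (g \<otimes> x))"
    using emb_edge(2)[OF assms one_in_projs] assms
    by (simp add: emb_proj_one emb_closed letter_carrier projs_carrier)
  ultimately show ?thesis using B.star_right by metis
qed

text \<open>In the quotient, \<open>g x (g x)\<^sup>* = g x\<close> allows one to move \<open>g\<close> to the right through the expression,
  lowering the vertices on its way.\<close>

lemma expr_val_restr:
  "\<lbrakk>path_expr (e, w); g \<in> projs S; g \<otimes> e = g\<rbrakk>
    \<Longrightarrow> expr_val S X (g, restr_tail g w) = emb_proj S X g \<otimes>\<^bsub>BGG S X\<^esub> expr_val S X (e, w)"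
proof (induction w arbitrary: e g)
  case Nil
  then show ?case by (simp add: emb_proj_mult)
next
  case (Cons c w)
  interpret B: ehresmann_monoid "BGG S X" by (rule BGG_ehresmann)
  obtain x f where [simp]: "c = (x, f)" by force
  let ?k = "estar S (g \<otimes> x)" and ?v = "expr_val S X (f, w)"
  let ?i = "emb_proj S X" and ?l = "emb_letter S X x"
  have c: "x \<in> X" "e \<in> projs S" "f \<in> projs S" "path_expr (f, w)"
    using Cons.prems by (auto simp: letter_edge_iff)
  have cc: "g \<in> carrier S" "f \<in> carrier S" "x \<in> carrier S"
    using c Cons.prems by (auto simp: letter_carrier projs_carrier)
  have k: "?k \<in> projs S" "?k \<in> carrier S" using cc by (auto simp: star_in_projs star_closed)
  have b: "?i g \<in> carrier (BGG S X)" "?i e \<in> carrier (BGG S X)" "?i f \<in> carrier (BGG S X)"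
    "?i ?k \<in> carrier (BGG S X)" "?l \<in> carrier (BGG S X)" "?v \<in> carrier (BGG S X)"
    using c k Cons.prems by (auto simp: emb_closed expr_val_closed)
  have IH: "expr_val S X (?k \<otimes> f, restr_tail (?k \<otimes> f) w) = ?i (?k \<otimes> f) \<otimes>\<^bsub>BGG S X\<^esub> ?v"
    by (rule Cons.IH) (use c k cc in \<open>auto simp: proj_mult_closed m_assoc proj_idem\<close>)
  also have "\<dots> = ?i ?k \<otimes>\<^bsub>BGG S X\<^esub> ?v"
    using c k b by (simp add: emb_src_expr_val B.m_assoc flip: emb_proj_mult)
  finally have "expr_val S X (g, restr_tail g (c # w)) =
      (?i g \<otimes>\<^bsub>BGG S X\<^esub> ?l \<otimes>\<^bsub>BGG S X\<^esub> ?i ?k) \<otimes>\<^bsub>BGG S X\<^esub> ?v"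
    using b by (simp add: B.m_assoc)
  also have "\<dots> = (?i g \<otimes>\<^bsub>BGG S X\<^esub> ?l) \<otimes>\<^bsub>BGG S X\<^esub> ?v"
    using emb_letter_star Cons.prems c by simp
  also have "\<dots> = ((?i g \<otimes>\<^bsub>BGG S X\<^esub> ?i e) \<otimes>\<^bsub>BGG S X\<^esub> ?l) \<otimes>\<^bsub>BGG S X\<^esub> ?v"
    using Cons.prems c by (simp add: emb_proj_mult)
  finally show ?case using b by (simp add: B.m_assoc)
qed

lemma expr_val_proj_act:
  assumes "g \<in> projs S" "path_expr p"
  shows "expr_val S X (proj_act g p) = emb_proj S X g \<otimes>\<^bsub>BGG S X\<^esub> expr_val S X p"
proof -
  interpret B: ehresmann_monoid "BGG S X" by (rule BGG_ehresmann)
  obtain e w where p: "p = (e, w)" by force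
  have e: "e \<in> projs S" "e \<in> carrier S" "g \<in> carrier S"
    using path_expr_src[of p] assms p by (auto simp: projs_carrier)
  have "expr_val S X (proj_act g p) = emb_proj S X (g \<otimes> e) \<otimes>\<^bsub>BGG S X\<^esub> expr_val S X p"
    using assms e expr_val_restr[of e w "g \<otimes> e"]
    by (simp add: p proj_act_def proj_mult_closed m_assoc proj_idem)
  also have "\<dots> = emb_proj S X g \<otimes>\<^bsub>BGG S X\<^esub> (emb_proj S X e \<otimes>\<^bsub>BGG S X\<^esub> expr_val S X p)"
    using assms e by (simp add: emb_closed expr_val_closed B.m_assoc flip: emb_proj_mult)
  finally show ?thesis using assms p by (simp add: emb_src_expr_val)
qed

text \<open>With \<open>y = x e\<close>, the letter action replaces \<open>y\<close> by \<open>y\<^sup>+ y y\<^sup>*\<close>, which does not change the value.\<close>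

lemma expr_val_letter_act:
  assumes "x \<in> X" "path_expr p"
  shows "expr_val S X (letter_act x p) = emb_letter S X x \<otimes>\<^bsub>BGG S X\<^esub> expr_val S X p"
proof -
  interpret B: ehresmann_monoid "BGG S X" by (rule BGG_ehresmann)
  obtain e w where p: "p = (e, w)" by force
  let ?k = "estar S (x \<otimes> e)" and ?h = "eplus S (x \<otimes> e)" and ?v = "expr_val S X p"
  let ?i = "emb_proj S X" and ?l = "emb_letter S X x"
  let ?y = "?l \<otimes>\<^bsub>BGG S X\<^esub> ?i e"
  have e: "e \<in> projs S" "e \<in> carrier S" "x \<in> carrier S"
    using path_expr_src[of p] assms p by (auto simp: projs_carrier letter_carrier)
  then have k: "?k \<in> projs S" "?h \<in> projs S" by (auto simp: star_in_projs plus_in_projs)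
  have b: "?i e \<in> carrier (BGG S X)" "?i ?k \<in> carrier (BGG S X)" "?i ?h \<in> carrier (BGG S X)"
    "?l \<in> carrier (BGG S X)" "?v \<in> carrier (BGG S X)"
    using e k assms by (auto simp: emb_closed expr_val_closed)
  have y: "eplus (BGG S X) ?y = ?i ?h" "estar (BGG S X) ?y = ?i ?k"
    using emb_edge[OF one_in_projs assms(1) e(1)] e b by (simp_all add: emb_proj_one)
  have v: "?i e \<otimes>\<^bsub>BGG S X\<^esub> ?v = ?v" using assms p by (simp add: emb_src_expr_val)
  have ke: "?i e \<otimes>\<^bsub>BGG S X\<^esub> ?i ?k = ?i ?k"
    using e k by (simp add: emb_proj_mult proj_comm[of e] star_mult_below)
  have "expr_val S X (letter_act x p) = ?i ?h \<otimes>\<^bsub>BGG S X\<^esub> ?l \<otimes>\<^bsub>BGG S X\<^esub> (?i ?k \<otimes>\<^bsub>BGG S X\<^esub> ?v)"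
    using assms e k expr_val_restr[of e w ?k] by (simp add: p letter_act_def star_mult_below)
  also have "\<dots> = ?i ?h \<otimes>\<^bsub>BGG S X\<^esub> (?y \<otimes>\<^bsub>BGG S X\<^esub> ?i ?k) \<otimes>\<^bsub>BGG S X\<^esub> ?v"
    using b ke by (simp add: B.m_assoc)
  also have "\<dots> = ?y \<otimes>\<^bsub>BGG S X\<^esub> ?v"
    using b B.star_right[of ?y] B.plus_left[of ?y] by (simp add: y)
  also have "\<dots> = ?l \<otimes>\<^bsub>BGG S X\<^esub> ?v" using b v by (simp add: B.m_assoc)
  finally show ?thesis .
qed

lemma expr_val_letters_act:
  "\<lbrakk>t \<in> lists X; path_expr p\<rbrakk>
    \<Longrightarrow> expr_val S X (foldr letter_act t p) = word_val [Inl t] \<otimes>\<^bsub>BGG S X\<^esub> expr_val S X p"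
proof (induction t)
  case Nil
  interpret B: ehresmann_monoid "BGG S X" by (rule BGG_ehresmann)
  have "word_val [Inl []] = \<one>\<^bsub>BGG S X\<^esub>"
    using word_val_cong[OF fp_cong.one_left] by (simp add: word_val_one)
  then show ?case using Nil by (simp add: expr_val_closed)
next
  case (Cons x t)
  interpret B: ehresmann_monoid "BGG S X" by (rule BGG_ehresmann)
  have w: "[Inl [x]] \<in> fpwords S X" "[Inl t] \<in> fpwords S X" using Cons.prems by auto
  have "word_val [Inl (x # t)] = word_val [Inl [x]] \<otimes>\<^bsub>BGG S X\<^esub> word_val [Inl t]"
    using word_val_append[OF w] word_val_cong[OF fp_cong.mult_left[of "[x]" X t S]] Cons.prems by simp
  then show ?case using Cons w
    by (simp add: expr_val_letter_act letters_act_closed emb_word_val word_val_closed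
        expr_val_closed B.m_assoc)
qed

text \<open>Existence of canonical forms: the rewriting performed by the actions is valid in the quotient.\<close>

lemma word_val_canonical: "u \<in> fpwords S X \<Longrightarrow> expr_val S X (word_expr u) = word_val u"
proof (induction u)
  case Nil
  then show ?case by (simp add: word_expr_def emb_proj_one word_val_one)
next
  case (Cons a u)
  have "expr_val S X (fp_act a (word_expr u)) = word_val [a] \<otimes>\<^bsub>BGG S X\<^esub> expr_val S X (word_expr u)"
    using Cons.prems word_expr_closed
    by (cases a) (auto simp: expr_val_letters_act expr_val_proj_act emb_word_val)
  then show ?case using Cons word_val_append[of "[a]" u] by (simp add: word_expr_def)
qed

lemma BGG_expr_bij: "bij_betw BGG_expr (carrier (BGG S X)) (carrier expr_monoid)"
proof (rule bij_betw_byWitness[where f' = "expr_val S X"])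
  show "\<forall>C\<in>carrier (BGG S X). expr_val S X (BGG_expr C) = C"
    by (auto simp: BGG_carrier BGG_expr_word_val word_val_canonical)
  show "\<forall>w\<in>carrier expr_monoid. BGG_expr (expr_val S X w) = w"
    by (auto simp: expr_monoid_def BGG_expr_expr_val)
  show "BGG_expr ` carrier (BGG S X) \<subseteq> carrier expr_monoid"
    by (auto simp: BGG_carrier BGG_expr_word_val expr_monoid_def word_expr_closed)
  show "expr_val S X ` carrier expr_monoid \<subseteq> carrier (BGG S X)"
    by (auto simp: expr_monoid_def expr_val_closed)
qed

lemma BGG_expr_hom: "ehr_hom (BGG S X) expr_monoid BGG_expr"
proof -
  have "BGG_expr (eplus (BGG S X) C) = (fst (BGG_expr C), [])"
    "BGG_expr (estar (BGG S X) C) = (expr_tgt (BGG_expr C), [])" if "C \<in> carrier (BGG S X)" for C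
    using that
    by (auto simp: BGG_carrier word_val_unary BGG_expr_word_val BGG_expr_emb_proj word_expr_projs)
  moreover have "BGG_expr \<one>\<^bsub>BGG S X\<^esub> = (\<one>, [])"
    by (simp add: BGG_expr_word_val word_expr_def flip: word_val_one)
  moreover have "path_expr (BGG_expr C)" if "C \<in> carrier (BGG S X)" for C
    using bij_betwE[OF BGG_expr_bij] that by (simp add: expr_monoid_def)
  ultimately show ?thesis
    by (simp add: ehr_hom_def hom_def expr_monoid_def BGG_expr_mult)
qed

lemma canonical_form_unique:
  assumes "C \<in> carrier (BGG S X)"
  shows "\<exists>!w. canonical S X w \<and> expr_val S X w = C"
proof (rule ex1I[of _ "BGG_expr C"])
  show "canonical S X (BGG_expr C) \<and> expr_val S X (BGG_expr C) = C"
    using assms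
    by (auto simp: canonical_iff_path_expr BGG_carrier BGG_expr_word_val word_val_canonical
        word_expr_closed)
  show "w = BGG_expr C" if "canonical S X w \<and> expr_val S X w = C" for w
    using that BGG_expr_expr_val canonical_iff_path_expr by metis
qed

lemma canonical_iso:
  "expr_class \<circ> BGG_expr \<in> ehr_iso (BGG S X) (path_monoid S X)"
  "canonical S X w \<Longrightarrow> (expr_class \<circ> BGG_expr) (expr_val S X w) = pclass S X (expr_path w)"
proof -
  note h = ehr_homD[OF BGG_expr_hom] and k = ehr_homD[OF expr_class_hom]
  have "bij_betw (expr_class \<circ> BGG_expr) (carrier (BGG S X)) (carrier (path_monoid S X))"
    using BGG_expr_bij expr_class_bij by (rule bij_betw_trans)
  then show "expr_class \<circ> BGG_expr \<in> ehr_iso (BGG S X) (path_monoid S X)"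
    by (auto simp: ehr_iso_def iso_def hom_def h k)
  show "(expr_class \<circ> BGG_expr) (expr_val S X w) = pclass S X (expr_path w)" if "canonical S X w"
    using that by (simp add: canonical_iff_path_expr BGG_expr_expr_val expr_class_def)
qed

end

theorem mainTheorem4:
  fixes S :: "('s, 'm) ehresmann_scheme" and X :: "'s set"
  assumes "ehresmann_monoid S"
    and "X \<subseteq> carrier S"
    and "ehr_generate S X = carrier S"
  shows "ehresmann_monoid (BGG S X) \<and> ehresmann_monoid (path_monoid S X) \<and>
    (\<forall>u \<in> carrier (BGG S X). \<exists>!w. canonical S X w \<and> expr_val S X w = u) \<and>
    (\<exists>\<phi> \<in> ehr_iso (BGG S X) (path_monoid S X).
       \<forall>w. canonical S X w \<longrightarrow> \<phi> (expr_val S X w) = pclass S X (expr_path w))"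
proof -
  interpret ehr_letters S X
    using assms by (simp add: ehr_letters_def ehr_letters_axioms_def)
  show ?thesis
    using BGG_ehresmann path_monoid_ehresmann canonical_form_unique canonical_iso by blast
qed

end
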